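(* There is a two-sided error distributed tester in the CONGEST model which, with parameters $\epsilon\in(0,1)$ and $\Phi\in(0,1]$, decides whether a graph $G=(V,E)$ has conductance at least $\Phi$ or is $\epsilon$-far from having conductance at least $\Phi^2/1000$, and which uses $O\big(\log(|V|+|E|)/(\epsilon\Phi^2)\big)$ rounds. That is: run on $G$, the algorithm terminates within $O(\log(|V|+|E|)/(\epsilon\Phi^2))$ rounds; if $G$ has conductance at least $\Phi$, then with probability at least $2/3$ every vertex outputs $1$ (accept); and if $G$ is $\epsilon$-far from having conductance at least $\Phi^2/1000$, then with probability at least $2/3$ at least one vertex outputs $0$ (reject).
   Context: Graphs are finite, simple and undirected; $n=|V|$, $m=|E|$, $d(v)$ is the degree of $v$. Conductance. For $S\subseteq V$ let $\bar S=V\setminus S$, $\mathrm{vol}(S)=\sum_{v\in S}d(v)$, and let $E(S,\bar S)$ be the set of edges with one endpoint in $S$ and the other in $\bar S$. For nonempty $S\subsetneq V$ with $\mathrm{vol}(S)\le\mathrm{vol}(\bar S)$, $\mathrm{cond}(S)=|E(S,\bar S)|/\mathrm{vol}(S)$ (read as $0$ if no edge leaves $S$). The conductance of $G$ is the minimum of $\mathrm{cond}(S)$ over all such $S$. $\epsilon$-far. A graph with $m$ edges is $\epsilon$-far from a property if at least $\epsilon m$ edges have to be modified (inserted or deleted) to obtain a graph on the same vertex set with the property. Distributed model. Each vertex $v$ of $G$ is a processor with its own randomness, connected to its neighbors through ports numbered $1,\dots,d(v)$ by an arbitrary bijection to its neighbors. Computation proceeds in synchronized rounds; in each round, every vertex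 (i) performs local computation, (ii) sends a message to each neighbor, (iii) receives the messages sent by its neighbors. In the LOCAL model the initial input of $v$ consists of $n$ and a unique numerical identifier from $\{1,\dots,n^{c}\}$ for a universal constant $c$. The CONGEST model is the LOCAL model with every message restricted to $O(\log n)$ bits. The same algorithm runs at every vertex and finally each vertex outputs one bit. The round complexity is the number of rounds until all vertices have terminated. *)

theory Defs
  imports "HOL-Probability.Probability" "HOL-Probability.Product_PMF"
begin

section \<open>Finite simple graphs and conductance\<close>

record 'a graph =
  verts :: "'a set"
  edges :: "'a set set"

definition simple_graph :: "'a graph \<Rightarrow> bool" where
  "simple_graph G \<longleftrightarrow> finite (verts G) \<and>
     edges G \<subseteq> {{u, v} | u v. u \<in> verts G \<and> v \<in> verts G \<and> u \<noteq> v}"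

definition neighbors :: "'a graph \<Rightarrow> 'a \<Rightarrow> 'a set" where
  "neighbors G v = {u. {u, v} \<in> edges G}"

definition degree :: "'a graph \<Rightarrow> 'a \<Rightarrow> nat" where
  "degree G v = card {e \<in> edges G. v \<in> e}"

definition vol :: "'a graph \<Rightarrow> 'a set \<Rightarrow> nat" where
  "vol G S = (\<Sum>v\<in>S. degree G v)"

definition edges_between :: "'a graph \<Rightarrow> 'a set \<Rightarrow> 'a set \<Rightarrow> 'a set set" where
  "edges_between G S T = {e \<in> edges G. \<exists>u\<in>S. \<exists>v\<in>T. e = {u, v}}"

text \<open>If no edge leaves \<open>S\<close>, the quotient is \<open>0\<close>, also when \<open>vol G S = 0\<close>
  (since \<open>0 / 0 = 0\<close>).\<close>
definition cond :: "'a graph \<Rightarrow> 'a set \<Rightarrow> real" where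
  "cond G S = real (card (edges_between G S (verts G - S))) / real (vol G S)"

text \<open>The set below is nonempty, i.e. the minimum exists, iff there are at least two vertices;
  \<open>conductance G\<close> is meaningful only for such graphs.\<close>
definition conductance :: "'a graph \<Rightarrow> real" where
  "conductance G =
     Min {cond G S | S. S \<noteq> {} \<and> S \<subset> verts G \<and> vol G S \<le> vol G (verts G - S)}"

definition eps_far :: "real \<Rightarrow> 'a graph \<Rightarrow> ('a graph \<Rightarrow> bool) \<Rightarrow> bool" where
  "eps_far \<epsilon> G P \<longleftrightarrow>
     (\<forall>H. simple_graph H \<and> verts H = verts G \<and> P H \<longrightarrow>
        \<epsilon> * real (card (edges G)) \<le> real (card ((edges G - edges H) \<union> (edges H - edges G))))"

section \<open>Synchronous message-passing algorithms\<close>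

text \<open>\<open>port v p\<close> is the neighbor that \<open>v\<close> reaches through its port \<open>p\<close>.\<close>
record 'a network =
  graph :: "'a graph"
  port :: "'a \<Rightarrow> nat \<Rightarrow> 'a"
  ident :: "'a \<Rightarrow> nat"

definition valid_network :: "nat \<Rightarrow> 'a network \<Rightarrow> bool" where
  "valid_network c N \<longleftrightarrow>
     simple_graph (graph N) \<and>
     (\<forall>v \<in> verts (graph N).
        bij_betw (port N v) {1..degree (graph N) v} (neighbors (graph N) v)) \<and>
     inj_on (ident N) (verts (graph N)) \<and>
     ident N ` verts (graph N) \<subseteq> {1..card (verts (graph N)) ^ c}"

type_synonym message = "bool list"

text \<open>
  The program run by every vertex, with local states of type \<open>'s\<close>.
  \<open>init n i\<close> is the initial state of the vertex with identifier \<open>i\<close> in a graph on \<open>n\<close> vertices.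
  In each round, \<open>compute\<close> is the randomized local computation (each application uses fresh
  private randomness), \<open>send s p\<close> is the message then sent through port \<open>p\<close>, and \<open>receive s xs\<close>
  is the state after the round, where \<open>xs\<close> lists the incoming messages in the order of the ports
  (so that its length is the degree of the vertex).
  \<open>out s = None\<close> means that the vertex is still running at the end of the round, and
  \<open>out s = Some b\<close> that it has terminated with output bit \<open>b\<close>.
\<close>
record 's algorithm =
  init :: "nat \<Rightarrow> nat \<Rightarrow> 's"
  compute :: "'s \<Rightarrow> 's pmf"
  send :: "'s \<Rightarrow> nat \<Rightarrow> message"
  receive :: "'s \<Rightarrow> message list \<Rightarrow> 's"
  out :: "'s \<Rightarrow> bool option"

text \<open>Below, \<open>s\<close> is the configuration (assignment of states to vertices) at the beginning of a
  round and \<open>s'\<close> the one after the local computations of that round. Vertices terminated in \<open>s\<close>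
  keep their state and are silent, which their neighbors perceive as the empty message.
  The vertices draw their randomness independently of each other.\<close>

definition local_computation :: "'s algorithm \<Rightarrow> 'a network \<Rightarrow> ('a \<Rightarrow> 's) \<Rightarrow> ('a \<Rightarrow> 's) pmf" where
  "local_computation A N s =
     Pi_pmf (verts (graph N)) undefined
       (\<lambda>v. if out A (s v) = None then compute A (s v) else return_pmf (s v))"

definition sent :: "'s algorithm \<Rightarrow> ('a \<Rightarrow> 's) \<Rightarrow> ('a \<Rightarrow> 's) \<Rightarrow> 'a \<Rightarrow> nat \<Rightarrow> message" where
  "sent A s s' v p = (if out A (s v) = None then send A (s' v) p else [])"

definition port_to :: "'a network \<Rightarrow> 'a \<Rightarrow> 'a \<Rightarrow> nat" where
  "port_to N u v = the_inv_into {1..degree (graph N) u} (port N u) v"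

definition inbox ::
    "'s algorithm \<Rightarrow> 'a network \<Rightarrow> ('a \<Rightarrow> 's) \<Rightarrow> ('a \<Rightarrow> 's) \<Rightarrow> 'a \<Rightarrow> message list" where
  "inbox A N s s' v =
     map (\<lambda>p. let u = port N v p in sent A s s' u (port_to N u v))
       [1..<Suc (degree (graph N) v)]"

definition communicate ::
    "'s algorithm \<Rightarrow> 'a network \<Rightarrow> ('a \<Rightarrow> 's) \<Rightarrow> ('a \<Rightarrow> 's) \<Rightarrow> ('a \<Rightarrow> 's)" where
  "communicate A N s s' =
     (\<lambda>v. if out A (s v) = None then receive A (s' v) (inbox A N s s' v) else s v)"

definition one_round :: "'s algorithm \<Rightarrow> 'a network \<Rightarrow> ('a \<Rightarrow> 's) \<Rightarrow> ('a \<Rightarrow> 's) pmf" where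
  "one_round A N s = map_pmf (communicate A N s) (local_computation A N s)"

text \<open>The distribution of the configuration after \<open>t\<close> rounds.\<close>
primrec run :: "'s algorithm \<Rightarrow> 'a network \<Rightarrow> nat \<Rightarrow> ('a \<Rightarrow> 's) pmf" where
  "run A N 0 = return_pmf (\<lambda>v. init A (card (verts (graph N))) (ident N v))"
| "run A N (Suc t) = bind_pmf (run A N t) (one_round A N)"

text \<open>All messages sent in any possible execution have at most \<open>K * log 2 n\<close> bits.\<close>
definition congest :: "real \<Rightarrow> 's algorithm \<Rightarrow> 'a network \<Rightarrow> bool" where
  "congest K A N \<longleftrightarrow>
     (\<forall>t. \<forall>s \<in> set_pmf (run A N t). \<forall>s' \<in> set_pmf (local_computation A N s).
        \<forall>v \<in> verts (graph N). \<forall>p \<in> {1..degree (graph N) v}.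
          real (length (sent A s s' v p)) \<le> K * log 2 (real (card (verts (graph N)))))"

definition terminates_within :: "'s algorithm \<Rightarrow> 'a network \<Rightarrow> nat \<Rightarrow> bool" where
  "terminates_within A N t \<longleftrightarrow>
     (\<forall>s \<in> set_pmf (run A N t). \<forall>v \<in> verts (graph N). out A (s v) \<noteq> None)"

definition all_accept :: "'s algorithm \<Rightarrow> 'a network \<Rightarrow> ('a \<Rightarrow> 's) set" where
  "all_accept A N = {s. \<forall>v \<in> verts (graph N). out A (s v) = Some True}"

definition some_reject :: "'s algorithm \<Rightarrow> 'a network \<Rightarrow> ('a \<Rightarrow> 's) set" where
  "some_reject A N = {s. \<exists>v \<in> verts (graph N). out A (s v) = Some False}"

end

(*
  The tester does not need the distance parameter: it separates conductance at least \<Phi> from conductance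
  below \<Phi>^2/1000. Every vertex carries two numbers that are diffused by the lazy random walk W in
  fixed-point arithmetic, with scale n^40, for T = O(log n / \<Phi>^2) rounds. By Cheeger's inequality
  conductance \<Phi> makes both numbers converge to their degree-weighted averages.

  The first number starts with mass -1 at every vertex, plus n at every vertex that sees no identifier smaller
  than its own after T rounds of flooding. A component I with k such leaders has average proportional to
  k n - |I|, where k >= 1; this vanishes only if I is the whole graph and k = 1. So if every vertex ends up with
  almost zero, the graph is connected. The second number starts with a uniform value in {0, 1, 2}. If all neighbors
  end up with nearly equal values and the graph is connected, then the vector W^T z is nearly
  constant, hence almost orthogonal to the centered indicator h of a sparse cut, and so <W^T h, z> is tiny. But
  the moments <h, W^k h> are log-convex, so W^T h has a coefficient that is only polynomially small, and, given
  the other values, at most one of the three values of z at that vertex makes <W^T h, z> tiny.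

  Since a connected graph has conductance at least 1/n^2, one may replace \<Phi> by max \<Phi> (1/n^2), which keeps T, and
  thus the accumulated rounding error, polynomial in n.
*)
theory Submission
  imports Defs
begin

section \<open>Cuts and neighborhoods\<close>

text \<open>The gap between \<Phi> and \<Phi>^2/1000 is the loss in Cheeger's inequality:
  conductance \<phi> only guarantees that the squared distance to the average shrinks by 1 -
  \<phi>^2/4 per step, while a cut of conductance \<delta> only guarantees survival of a factor 1 -
  \<delta>. One walk length must serve both sides. With T about 360 ln n / \<phi>^2 the first factor
  falls below n^-90, which beats the squared initial norm at scale n^40, whereas (1 -
  \<phi>^2/1000)^T stays above 1/n because 360 * 2/1000 < 1.

  Fixed-point numbers are forced by messages of O(log n) bits. Comparing neighbors says nothing
  across components, so connectivity needs a certificate of its own; once it is there, local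
  agreement becomes global agreement at the cost of a factor n.

  Acceptance under large conductance is certain. Randomness serves rejection: a fixed start vector
  could happen to be orthogonal to W^T h for the unknown cut.\<close>

locale finite_graph =
  fixes G :: "'a graph"
  assumes simple: "simple_graph G"
begin

lemma finite_verts: "finite (verts G)"
  using simple by (simp add: simple_graph_def)

lemma neighbors_in_verts: "u \<in> neighbors G v \<Longrightarrow> u \<in> verts G"
  using simple by (auto simp: simple_graph_def neighbors_def doubleton_eq_iff)

lemma neighbors_sym: "u \<in> neighbors G v \<longleftrightarrow> v \<in> neighbors G u"
  by (auto simp: neighbors_def insert_commute)

lemma neighbors_irrefl: "v \<notin> neighbors G v"
  using simple by (auto simp: simple_graph_def neighbors_def doubleton_eq_iff)

lemma finite_neighbors: "finite (neighbors G v)"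
  using neighbors_in_verts finite_verts by (meson finite_subset subsetI)

lemma edgeE:
  assumes "e \<in> edges G"
  obtains u v where "e = {u, v}" "u \<in> verts G" "v \<in> verts G" "u \<noteq> v"
  using assms simple by (force simp: simple_graph_def)

lemma degree_eq_card_neighbors: "degree G v = card (neighbors G v)"
proof -
  have "bij_betw (\<lambda>u. {u, v}) (neighbors G v) {e \<in> edges G. v \<in> e}"
  proof (rule bij_betw_imageI)
    show "inj_on (\<lambda>u. {u, v}) (neighbors G v)"
      by (auto simp: inj_on_def doubleton_eq_iff)
    show "(\<lambda>u. {u, v}) ` neighbors G v = {e \<in> edges G. v \<in> e}"
    proof (intro equalityI subsetI)
      fix e assume e: "e \<in> {e \<in> edges G. v \<in> e}"
      then obtain a b where "e = {a, b}" by (auto elim: edgeE)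
      with e have "\<exists>u. e = {u, v}" by (auto intro: insert_commute)
      with e show "e \<in> (\<lambda>u. {u, v}) ` neighbors G v"
        by (auto simp: neighbors_def)
    qed (auto simp: neighbors_def)
  qed
  then show ?thesis by (simp add: degree_def bij_betw_same_card)
qed

lemma degree_less_card: "v \<in> verts G \<Longrightarrow> degree G v < card (verts G)"
  unfolding degree_eq_card_neighbors
  by (rule psubset_card_mono[OF finite_verts]) (use neighbors_in_verts neighbors_irrefl in blast)

lemma vol_le: "vol G (verts G) \<le> (card (verts G))\<^sup>2"
proof -
  have "vol G (verts G) \<le> (\<Sum>v\<in>verts G. card (verts G))"
    unfolding vol_def by (intro sum_mono) (simp add: degree_less_card less_imp_le)
  then show ?thesis by (simp add: power2_eq_square)
qed

lemma vol_mono: "S \<subseteq> T \<Longrightarrow> T \<subseteq> verts G \<Longrightarrow> vol G S \<le> vol G T"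
  unfolding vol_def by (rule sum_mono2) (use finite_verts finite_subset in auto)

lemma vol_Diff: "S \<subseteq> verts G \<Longrightarrow> vol G (verts G - S) = vol G (verts G) - vol G S"
  unfolding vol_def using sum.subset_diff[of S "verts G" "degree G"] finite_verts by simp

lemma sum_neighbors_swap:
  "(\<Sum>v\<in>verts G. \<Sum>u\<in>neighbors G v. F v u) = (\<Sum>v\<in>verts G. \<Sum>u\<in>neighbors G v. F u v)"
  for F :: "'a \<Rightarrow> 'a \<Rightarrow> real"
proof -
  have "(\<Sum>v\<in>verts G. \<Sum>u\<in>neighbors G v. F v u) =
        (\<Sum>v\<in>verts G. \<Sum>u | u \<in> verts G \<and> u \<in> neighbors G v. F v u)"
    by (intro sum.cong) (auto simp: neighbors_in_verts)
  also have "\<dots> = (\<Sum>u\<in>verts G. \<Sum>v | v \<in> verts G \<and> u \<in> neighbors G v. F v u)"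
    by (rule sum.swap_restrict) (simp_all add: finite_verts)
  also have "\<dots> = (\<Sum>u\<in>verts G. \<Sum>v\<in>neighbors G u. F v u)"
    by (intro sum.cong) (auto dest: neighbors_sym[THEN iffD1] intro: neighbors_in_verts)
  finally show ?thesis .
qed

lemma card_edges_between:
  assumes "S \<subseteq> verts G"
  shows "real (card (edges_between G S (verts G - S))) = (\<Sum>v\<in>S. real (card (neighbors G v - S)))"
proof -
  have fS: "finite S" using assms finite_verts finite_subset by blast
  have "bij_betw (\<lambda>(v, u). {v, u}) (SIGMA v:S. neighbors G v - S) (edges_between G S (verts G - S))"
  proof (rule bij_betw_imageI)
    show "inj_on (\<lambda>(v, u). {v, u}) (SIGMA v:S. neighbors G v - S)"
      by (auto simp: inj_on_def doubleton_eq_iff)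
    show "(\<lambda>(v, u). {v, u}) ` (SIGMA v:S. neighbors G v - S) = edges_between G S (verts G - S)"
    proof (intro equalityI subsetI)
      fix e assume "e \<in> (\<lambda>(v, u). {v, u}) ` (SIGMA v:S. neighbors G v - S)"
      then obtain v u where "v \<in> S" "u \<in> neighbors G v" "u \<notin> S" "e = {v, u}" by auto
      then show "e \<in> edges_between G S (verts G - S)"
        using neighbors_in_verts[of u v]
        by (auto simp: edges_between_def neighbors_def insert_commute)
    next
      fix e assume "e \<in> edges_between G S (verts G - S)"
      then obtain v u where "v \<in> S" "u \<in> verts G - S" "e = {v, u}" "e \<in> edges G"
        by (auto simp: edges_between_def)
      then show "e \<in> (\<lambda>(v, u). {v, u}) ` (SIGMA v:S. neighbors G v - S)"
        by (auto simp: neighbors_def insert_commute intro!: image_eqI[of _ _ "(v, u)"])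
    qed
  qed
  then have "card (edges_between G S (verts G - S)) = card (SIGMA v:S. neighbors G v - S)"
    by (simp add: bij_betw_same_card)
  also have "\<dots> = (\<Sum>v\<in>S. card (neighbors G v - S))"
    using fS finite_neighbors by simp
  finally show ?thesis by simp
qed

lemma sum_neighbors_indicator:
  assumes "S \<subseteq> verts G"
  shows "(\<Sum>v\<in>verts G. \<Sum>u\<in>neighbors G v. of_bool (v \<in> S \<and> u \<notin> S)) =
    real (card (edges_between G S (verts G - S)))"
proof -
  have "(\<Sum>u\<in>neighbors G v. of_bool (v \<in> S \<and> u \<notin> S)) =
     (if v \<in> S then real (card (neighbors G v - S)) else 0)" for v
    by (auto simp: finite_neighbors Diff_eq Compl_eq)
  then show ?thesis
    unfolding card_edges_between[OF assms]
    using assms by (simp add: finite_verts sum.If_cases Int_absorb1)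
qed

end

section \<open>The lazy random walk\<close>

text \<open>The weights are the stationary measure of the walk, up to scaling, which makes
  \<open>lazy_walk\<close> self-adjoint. Values outside \<open>verts G\<close> do not count, so the
  form is only semidefinite.\<close>

definition deg_inner :: "'a graph \<Rightarrow> ('a \<Rightarrow> real) \<Rightarrow> ('a \<Rightarrow> real) \<Rightarrow> real" where
  "deg_inner G f g = (\<Sum>v\<in>verts G. real (degree G v) * f v * g v)"

text \<open>Every edge occurs in both orientations, so this is twice the usual Dirichlet
  form.\<close>

definition energy :: "'a graph \<Rightarrow> ('a \<Rightarrow> real) \<Rightarrow> real" where
  "energy G f = (\<Sum>v\<in>verts G. \<Sum>u\<in>neighbors G v. (f v - f u)\<^sup>2)"

text \<open>This is W = (I + P) / 2, acting on functions by averaging. Laziness makes W positive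
  semidefinite, which keeps the odd moments nonnegative. At an isolated vertex division by zero
  halves the value, so constants are preserved only where degrees are positive.\<close>

definition lazy_walk :: "'a graph \<Rightarrow> ('a \<Rightarrow> real) \<Rightarrow> 'a \<Rightarrow> real" where
  "lazy_walk G f v = (f v + (\<Sum>u\<in>neighbors G v. f u) / real (degree G v)) / 2"

lemma psd_form_Cauchy_Schwarz:
  fixes B :: "('a \<Rightarrow> real) \<Rightarrow> ('a \<Rightarrow> real) \<Rightarrow> real"
  assumes add: "\<And>f g h. B (\<lambda>v. f v + g v) h = B f h + B g h"
    and scale: "\<And>(c) f h. B (\<lambda>v. c * f v) h = c * B f h"
    and sym: "\<And>f g. B f g = B g f" and nonneg: "\<And>f. B f f \<ge> 0"
  shows "(B f g)\<^sup>2 \<le> B f f * B g g"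
proof -
  have expand: "B (\<lambda>v. x * f v + y * g v) (\<lambda>v. x * f v + y * g v) =
      x\<^sup>2 * B f f + 2 * x * y * B f g + y\<^sup>2 * B g g" for x y
    by (simp add: add scale sym[of _ "\<lambda>v. x * f v + y * g v"] sym[of g f]
         power2_eq_square algebra_simps)
  show ?thesis
  proof (cases "B g g = 0")
    case False
    then have pos: "B g g > 0" using nonneg[of g] by simp
    have "0 \<le> B g g * (B f f * B g g - (B f g)\<^sup>2)"
      using nonneg[of "\<lambda>v. B g g * f v + (- B f g) * g v"]
      unfolding expand by (simp add: power2_eq_square algebra_simps)
    then show ?thesis using pos by (simp add: zero_le_mult_iff)
  next
    case True
    have "B f g = 0"
    proof (rule ccontr)
      assume ne: "B f g \<noteq> 0"
      \<comment> \<open>In a null direction the quadratic is affine; this multiple of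
        \<open>g\<close> brings it down to -1.\<close>
      have "0 \<le> B f f + 2 * (- (B f f + 1) / (2 * B f g)) * B f g"
        using nonneg[of "\<lambda>v. 1 * f v + (- (B f f + 1) / (2 * B f g)) * g v"]
        unfolding expand by (simp add: True)
      also have "\<dots> = - 1" using ne by (simp add: field_simps)
      finally show False by simp
    qed
    then show ?thesis by (simp add: True)
  qed
qed

locale positive_degree_graph = finite_graph +
  assumes degree_pos: "v \<in> verts G \<Longrightarrow> degree G v > 0"
begin

lemma deg_inner_neighbors_left: "deg_inner G f g = (\<Sum>v\<in>verts G. \<Sum>u\<in>neighbors G v. f v * g v)"
  by (simp add: deg_inner_def degree_eq_card_neighbors mult.assoc)

lemma deg_inner_neighbors_right: "deg_inner G f g = (\<Sum>v\<in>verts G. \<Sum>u\<in>neighbors G v. f u * g u)"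
  unfolding deg_inner_neighbors_left by (rule sum_neighbors_swap)

lemma deg_inner_commute: "deg_inner G f g = deg_inner G g f"
  unfolding deg_inner_def by (simp add: mult_ac)

lemma deg_inner_nonneg: "deg_inner G f f \<ge> 0"
  unfolding deg_inner_def by (intro sum_nonneg) (simp add: mult.assoc)

lemma vol_pos: "verts G \<noteq> {} \<Longrightarrow> vol G (verts G) > 0"
  unfolding vol_def using degree_pos finite_verts by (simp add: card_gt_0_iff sum_pos)

lemma lazy_walk_inner:
  "deg_inner G (lazy_walk G f) g =
     (deg_inner G f g + (\<Sum>v\<in>verts G. \<Sum>u\<in>neighbors G v. f u * g v)) / 2"
proof -
  have "deg_inner G (lazy_walk G f) g =
     (\<Sum>v\<in>verts G. (real (degree G v) * f v * g v + (\<Sum>u\<in>neighbors G v. f u * g v)) / 2)"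
    unfolding deg_inner_def lazy_walk_def
    using degree_pos by (intro sum.cong refl) (simp add: field_simps flip: sum_distrib_left sum_distrib_right)
  then show ?thesis
    by (simp add: deg_inner_def sum.distrib flip: sum_divide_distrib)
qed

lemma lazy_walk_self_adjoint: "deg_inner G (lazy_walk G f) g = deg_inner G f (lazy_walk G g)"
proof -
  have "(\<Sum>v\<in>verts G. \<Sum>u\<in>neighbors G v. f u * g v) = (\<Sum>v\<in>verts G. \<Sum>u\<in>neighbors G v. g u * f v)"
    by (subst sum_neighbors_swap) (simp add: mult.commute)
  then show ?thesis
    by (simp add: deg_inner_commute[of f] lazy_walk_inner)
qed

lemma lazy_walk_pow_self_adjoint:
  "deg_inner G ((lazy_walk G ^^ t) f) g = deg_inner G f ((lazy_walk G ^^ t) g)"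
proof (induction t arbitrary: g)
  case (Suc t)
  have "deg_inner G ((lazy_walk G ^^ Suc t) f) g = deg_inner G ((lazy_walk G ^^ t) f) (lazy_walk G g)"
    by (simp add: lazy_walk_self_adjoint)
  also have "\<dots> = deg_inner G f ((lazy_walk G ^^ Suc t) g)"
    by (simp add: Suc funpow_swap1)
  finally show ?case .
qed simp

text \<open>One factor 2 counts both orientations of an edge, the other comes from I - W = (I - P) /
  2.\<close>

lemma energy_eq: "energy G f = 4 * (deg_inner G f f - deg_inner G (lazy_walk G f) f)"
proof -
  have "energy G f = (\<Sum>v\<in>verts G. \<Sum>u\<in>neighbors G v. f v * f v + f u * f u - 2 * (f u * f v))"
    unfolding energy_def by (simp add: power2_eq_square algebra_simps)
  also have "\<dots> = 2 * deg_inner G f f - 2 * (\<Sum>v\<in>verts G. \<Sum>u\<in>neighbors G v. f u * f v)"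
    by (simp add: sum.distrib sum_subtractf sum_distrib_left[of 2, symmetric]
          deg_inner_neighbors_left[symmetric] deg_inner_neighbors_right[symmetric] del: sum_constant)
  finally show ?thesis by (simp add: lazy_walk_inner field_simps)
qed

text \<open>Four times this quantity is the energy with \<open>f v + f u\<close> in place of
  \<open>f v - f u\<close>.\<close>

lemma lazy_walk_psd: "deg_inner G (lazy_walk G f) f \<ge> 0"
proof -
  have "0 \<le> (\<Sum>v\<in>verts G. \<Sum>u\<in>neighbors G v. (f v + f u)\<^sup>2)"
    by (intro sum_nonneg) simp
  also have "\<dots> = (\<Sum>v\<in>verts G. \<Sum>u\<in>neighbors G v. f v * f v + f u * f u + 2 * (f u * f v))"
    by (simp add: power2_eq_square algebra_simps)
  also have "\<dots> = 2 * deg_inner G f f + 2 * (\<Sum>v\<in>verts G. \<Sum>u\<in>neighbors G v. f u * f v)"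
    by (simp add: sum.distrib sum_distrib_left[of 2, symmetric]
          deg_inner_neighbors_left[symmetric] deg_inner_neighbors_right[symmetric] del: sum_constant)
  finally show ?thesis by (simp add: lazy_walk_inner field_simps)
qed

text \<open>With \<open>W = (I + P) / 2\<close> one has \<open>W - W\<^sup>2 = (I - P\<^sup>2) / 4\<close>, and \<open>P\<close> does not increase the norm.\<close>
lemma lazy_walk_norm_le: "deg_inner G (lazy_walk G f) (lazy_walk G f) \<le> deg_inner G (lazy_walk G f) f"
proof -
  define p where "p v = (\<Sum>u\<in>neighbors G v. f u) / real (degree G v)" for v
  have "real (degree G v) * p v * p v \<le> (\<Sum>u\<in>neighbors G v. f u * f u)" if "v \<in> verts G" for v
  proof -
    have "(\<Sum>u\<in>neighbors G v. f u)\<^sup>2 \<le> (\<Sum>u\<in>neighbors G v. (f u)\<^sup>2) * real (degree G v)"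
      using Cauchy_Schwarz_ineq_sum[of f "\<lambda>_. 1" "neighbors G v"]
      by (simp add: degree_eq_card_neighbors)
    then show ?thesis
      using degree_pos[OF that] unfolding p_def by (simp add: field_simps power2_eq_square)
  qed
  then have "deg_inner G p p \<le> deg_inner G f f"
    unfolding deg_inner_neighbors_right[of f] by (subst deg_inner_def) (rule sum_mono)
  moreover have "deg_inner G (lazy_walk G f) f - deg_inner G (lazy_walk G f) (lazy_walk G f) =
     (deg_inner G f f - deg_inner G p p) / 4"
    unfolding deg_inner_def lazy_walk_def p_def[symmetric]
    unfolding sum_subtractf[symmetric] sum_divide_distrib
    by (intro sum.cong refl) (simp add: field_simps)
  ultimately show ?thesis by (simp add: field_simps)
qed

lemma lazy_walk_const: "v \<in> verts G \<Longrightarrow> lazy_walk G (\<lambda>_. c) v = c"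
  using degree_pos by (fastforce simp: lazy_walk_def degree_eq_card_neighbors)

lemma lazy_walk_mono:
  assumes "\<And>v. v \<in> verts G \<Longrightarrow> f v \<le> g v" "v \<in> verts G"
  shows "lazy_walk G f v \<le> lazy_walk G g v"
  unfolding lazy_walk_def using assms
  by (intro divide_right_mono add_mono sum_mono) (auto dest: neighbors_in_verts)

lemma lazy_walk_cong:
  assumes "\<And>v. v \<in> verts G \<Longrightarrow> f v = g v" "v \<in> verts G"
  shows "lazy_walk G f v = lazy_walk G g v"
  using assms by (auto intro!: antisym lazy_walk_mono)

lemma lazy_walk_add: "lazy_walk G (\<lambda>v. f v + g v) v = lazy_walk G f v + lazy_walk G g v"
  by (simp add: lazy_walk_def sum.distrib add_divide_distrib)

lemma lazy_walk_diff_const: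
  "v \<in> verts G \<Longrightarrow> lazy_walk G (\<lambda>v. f v - c) v = lazy_walk G f v - c"
  using lazy_walk_add[of f "\<lambda>_. - c" v] lazy_walk_const[of v "- c"] by simp

lemma lazy_walk_pow_diff_const:
  "v \<in> verts G \<Longrightarrow> (lazy_walk G ^^ t) (\<lambda>v. f v - c) v = (lazy_walk G ^^ t) f v - c"
proof (induction t arbitrary: v)
  case (Suc t)
  have "lazy_walk G ((lazy_walk G ^^ t) (\<lambda>v. f v - c)) v = lazy_walk G (\<lambda>v. (lazy_walk G ^^ t) f v - c) v"
    using Suc by (intro lazy_walk_cong) auto
  then show ?case using Suc.prems by (simp add: lazy_walk_diff_const)
qed simp

lemma lazy_walk_pow_inner_const:
  "deg_inner G ((lazy_walk G ^^ t) f) (\<lambda>_. c) = deg_inner G f (\<lambda>_. c)"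
proof (induction t)
  case (Suc t)
  have "deg_inner G ((lazy_walk G ^^ t) f) (lazy_walk G (\<lambda>_. c)) = deg_inner G ((lazy_walk G ^^ t) f) (\<lambda>_. c)"
    unfolding deg_inner_def by (intro sum.cong) (simp_all add: lazy_walk_const)
  with Suc show ?case by (simp add: lazy_walk_self_adjoint)
qed simp

text \<open>The moments \<open>a\<^sub>k = \<langle>f, W\<^sup>k f\<rangle>\<close> are log-convex, by Cauchy--Schwarz for the two positive semidefinite
  forms \<open>\<langle>\<cdot>, \<cdot>\<rangle>\<close> and \<open>\<langle>W \<cdot>, \<cdot>\<rangle>\<close>; hence \<open>a\<^sub>t / a\<^sub>0 \<ge> (a\<^sub>1 / a\<^sub>0)\<^sup>t\<close>.\<close>
lemma lazy_walk_moment_log_convex: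
  "(deg_inner G f ((lazy_walk G ^^ Suc k) f))\<^sup>2 \<le>
     deg_inner G f ((lazy_walk G ^^ k) f) * deg_inner G f ((lazy_walk G ^^ Suc (Suc k)) f)"
proof -
  let ?W = "\<lambda>k. lazy_walk G ^^ k"
  have shift: "deg_inner G (?W i f) (?W j f) = deg_inner G f (?W (i + j) f)" for i j
    by (simp add: lazy_walk_pow_self_adjoint funpow_add)
  have scale: "lazy_walk G (\<lambda>v. c * g v) = (\<lambda>v. c * lazy_walk G g v)" for c g
    by (simp add: lazy_walk_def fun_eq_iff algebra_simps sum_distrib_left[symmetric])
  have ladd: "lazy_walk G (\<lambda>v. g v + h v) = (\<lambda>v. lazy_walk G g v + lazy_walk G h v)" for g h
    by (simp add: lazy_walk_add fun_eq_iff)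
  have lin1: "deg_inner G (\<lambda>v. f v + g v) h = deg_inner G f h + deg_inner G g h" for f g h
    by (simp add: deg_inner_def algebra_simps sum.distrib)
  have lin2: "deg_inner G (\<lambda>v. c * g v) h = c * deg_inner G g h" for c g h
    by (simp add: deg_inner_def algebra_simps sum_distrib_left)
  \<comment> \<open>The middle moment is a product of \<open>?W i f\<close> and
    \<open>?W (Suc i) f\<close>: for even k in the plain form, for odd k in the form with one more
    W.\<close>
  show ?thesis
  proof (cases "even k")
    case True
    then obtain i where k: "k = i + i" by (metis evenE mult_2)
    have "(deg_inner G (?W i f) (?W (Suc i) f))\<^sup>2 \<le>
       deg_inner G (?W i f) (?W i f) * deg_inner G (?W (Suc i) f) (?W (Suc i) f)"
      by (rule psd_form_Cauchy_Schwarz[of "deg_inner G"])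
        (simp_all only: lin1 lin2 deg_inner_commute deg_inner_nonneg)
    then show ?thesis unfolding shift k by simp
  next
    case False
    then obtain i where k: "k = Suc (i + i)" by (metis oddE mult_2 Suc_eq_plus1)
    have "(deg_inner G (lazy_walk G (?W i f)) (?W (Suc i) f))\<^sup>2 \<le>
       deg_inner G (lazy_walk G (?W i f)) (?W i f) * deg_inner G (lazy_walk G (?W (Suc i) f)) (?W (Suc i) f)"
      by (rule psd_form_Cauchy_Schwarz[of "\<lambda>f g. deg_inner G (lazy_walk G f) g"])
        (simp_all add: ladd scale lin1 lin2 lazy_walk_psd,
         metis deg_inner_commute lazy_walk_self_adjoint)
    moreover have "lazy_walk G (?W i f) = ?W (Suc i) f" for i by simp
    ultimately show ?thesis unfolding shift k by (simp only: shift add_Suc add_Suc_right)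
  qed
qed

text \<open>Log-convexity makes the ratios of consecutive moments nondecreasing, so a lower bound q
  on the first ratio persists. The induction is free of quotients because moments may
  vanish.\<close>

lemma lazy_walk_moment_ge:
  assumes "0 \<le> q" "q * deg_inner G f f \<le> deg_inner G f (lazy_walk G f)"
  shows "q ^ t * deg_inner G f f \<le> deg_inner G f ((lazy_walk G ^^ t) f)"
proof -
  define a where "a k = deg_inner G f ((lazy_walk G ^^ k) f)" for k
  have cvx: "(a (Suc k))\<^sup>2 \<le> a k * a (Suc (Suc k))" for k
    unfolding a_def by (rule lazy_walk_moment_log_convex)
  have "0 \<le> a k \<and> q * a k \<le> a (Suc k)" for k
  proof (induction k)
    case 0
    then show ?case using assms deg_inner_nonneg by (simp add: a_def)
  next
    case (Suc k)
    then have nn: "0 \<le> a k" "q * a k \<le> a (Suc k)" by auto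
    have pos: "0 \<le> a (Suc k)" using nn assms(1) by (meson mult_nonneg_nonneg order_trans)
    show ?case
    proof (cases "a (Suc k) = 0")
      case True
      \<comment> \<open>No division is possible here, but nonnegativity is enough: even moments are
        squared norms, odd ones are values of the semidefinite form of W.\<close>
      have "a (Suc (Suc k)) \<ge> 0"
      proof -
        have "deg_inner G f ((lazy_walk G ^^ (i + i)) f) \<ge> 0" for i
          by (metis deg_inner_nonneg funpow_add lazy_walk_pow_self_adjoint o_apply)
        moreover have "deg_inner G f ((lazy_walk G ^^ Suc (i + i)) f) \<ge> 0" for i
        proof -
          have "deg_inner G f ((lazy_walk G ^^ (i + Suc i)) f) = deg_inner G ((lazy_walk G ^^ i) f) (lazy_walk G ((lazy_walk G ^^ i) f))"
            unfolding funpow_add o_apply lazy_walk_pow_self_adjoint by simp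
          also have "\<dots> \<ge> 0" using lazy_walk_psd by (simp add: lazy_walk_self_adjoint)
          finally show ?thesis by simp
        qed
        ultimately show ?thesis
          unfolding a_def by (cases "even (Suc (Suc k))") (metis evenE mult_2 oddE Suc_eq_plus1)+
      qed
      then show ?thesis by (simp add: True)
    next
      case False
      then have p: "a (Suc k) > 0" using pos by simp
      then have "a k > 0" using cvx[of k] nn(1)
        by (metis less_eq_real_def mult_zero_left not_le zero_less_power)
      have "a k * (q * a (Suc k)) \<le> a (Suc k) * a (Suc k)"
        using mult_right_mono[OF nn(2) pos] by (simp add: mult_ac)
      also have "\<dots> \<le> a k * a (Suc (Suc k))" using cvx[of k] by (simp add: power2_eq_square)
      finally show ?thesis using \<open>a k > 0\<close> pos by simp
    qed
  qed
  then have step: "q * a k \<le> a (Suc k)" for k by blast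
  have "q ^ t * a 0 \<le> a t"
  proof (induction t)
    case (Suc t)
    have "q ^ Suc t * a 0 \<le> q * a t" using mult_left_mono[OF Suc assms(1)] by (simp add: mult_ac)
    also have "\<dots> \<le> a (Suc t)" by (rule step)
    finally show ?case .
  qed simp
  then show ?thesis by (simp add: a_def)
qed

text \<open>Orthogonality to constants survives each step, and W^2 \<le> W as quadratic forms, so
  the gap shrinks the squared norm by 1 - \<gamma> in every step.\<close>

lemma lazy_walk_contract:
  assumes gap: "\<gamma> \<le> 1" "\<And>f. deg_inner G f (\<lambda>_. 1) = 0 \<Longrightarrow> 4 * \<gamma> * deg_inner G f f \<le> energy G f"
    and "deg_inner G f (\<lambda>_. 1) = 0"
  shows "deg_inner G ((lazy_walk G ^^ t) f) ((lazy_walk G ^^ t) f) \<le> (1 - \<gamma>) ^ t * deg_inner G f f"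
proof (induction t)
  case (Suc t)
  let ?g = "(lazy_walk G ^^ t) f"
  have "deg_inner G ?g (\<lambda>_. 1) = 0" using assms(3) by (simp add: lazy_walk_pow_inner_const)
  note g = gap(2)[OF this]
  have "deg_inner G (lazy_walk G ?g) (lazy_walk G ?g) \<le> deg_inner G (lazy_walk G ?g) ?g"
    by (rule lazy_walk_norm_le)
  also have "\<dots> \<le> (1 - \<gamma>) * deg_inner G ?g ?g"
    using g unfolding energy_eq by (simp add: algebra_simps)
  also have "\<dots> \<le> (1 - \<gamma>) * ((1 - \<gamma>) ^ t * deg_inner G f f)"
    using Suc gap(1) by (intro mult_left_mono) auto
  finally show ?case by simp
qed simp

end

section \<open>Cheeger's inequality\<close>

context positive_degree_graph
begin

text \<open>A lower bound on conductance without minimum and division, so that empty sets and sets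
  of volume zero need no exception.\<close>

definition expands :: "real \<Rightarrow> bool" where
  "expands \<phi> \<longleftrightarrow> (\<forall>S. S \<subseteq> verts G \<and> 2 * vol G S \<le> vol G (verts G) \<longrightarrow>
     \<phi> * vol G S \<le> card (edges_between G S (verts G - S)))"

text \<open>Peel off the lowest level set of \<open>q\<close>; its cut contributes twice, once per orientation of an edge.\<close>
lemma coarea:
  fixes q :: "'a \<Rightarrow> real"
  assumes "expands \<phi>" "\<And>v. v \<in> verts G \<Longrightarrow> 0 \<le> q v"
    and "2 * vol G {v \<in> verts G. q v > 0} \<le> vol G (verts G)"
  shows "2 * \<phi> * (\<Sum>v\<in>verts G. degree G v * q v) \<le> (\<Sum>v\<in>verts G. \<Sum>u\<in>neighbors G v. \<bar>q v - q u\<bar>)"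
  using assms(2,3)
proof (induction "card {v \<in> verts G. q v > 0}" arbitrary: q rule: less_induct)
  case less
  define S where "S = {v \<in> verts G. q v > 0}"
  have S: "S \<subseteq> verts G" "finite S" using finite_verts by (auto simp: S_def)
  show ?case
  proof (cases "S = {}")
    case True
    then have "q v = 0" if "v \<in> verts G" for v
      using less.prems(1)[OF that] that by (force simp: S_def)
    then have "(\<Sum>v\<in>verts G. degree G v * q v) = 0" by simp
    then show ?thesis by (simp add: sum_nonneg)
  next
    case False
    define m where "m = Min (q ` S)"
    have m_le: "m \<le> q v" if "v \<in> S" for v using S that by (simp add: m_def)
    have "m \<in> q ` S" unfolding m_def using S False by (intro Min_in) auto
    then obtain w where w: "w \<in> S" "q w = m" by auto
    then have "m > 0" by (auto simp: S_def)
    define r where "r v = q v - m * of_bool (v \<in> S)" for v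
    have r0: "0 \<le> r v" if "v \<in> verts G" for v
      using less.prems(1)[OF that] m_le by (simp add: r_def)
    have sub: "{v \<in> verts G. r v > 0} \<subseteq> S"
      by (auto simp: r_def S_def of_bool_def split: if_splits)
    moreover have "w \<notin> {v \<in> verts G. r v > 0}" using w by (simp add: r_def)
    ultimately have "card {v \<in> verts G. r v > 0} < card {v \<in> verts G. q v > 0}"
      using w(1) S(2) unfolding S_def[symmetric] by (intro psubset_card_mono) auto
    moreover have "2 * vol G {v \<in> verts G. r v > 0} \<le> vol G (verts G)"
      using vol_mono[OF sub S(1)] less.prems(2) unfolding S_def[symmetric] by linarith
    ultimately have IH: "2 * \<phi> * (\<Sum>v\<in>verts G. degree G v * r v) \<le>
        (\<Sum>v\<in>verts G. \<Sum>u\<in>neighbors G v. \<bar>r v - r u\<bar>)"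
      using r0 by (intro less.hyps) auto
    have zero: "q v = 0" if "v \<in> verts G" "v \<notin> S" for v
      using less.prems(1)[OF that(1)] that by (force simp: S_def)
    \<comment> \<open>All values on S are at least m and all others are 0, so lowering S by m
      shortens exactly the edges across the cut, each by m.\<close>
    have abs_split: "\<bar>q v - q u\<bar> = \<bar>r v - r u\<bar> + m * of_bool (v \<in> S \<and> u \<notin> S) + m * of_bool (u \<in> S \<and> v \<notin> S)"
      if "v \<in> verts G" "u \<in> verts G" for u v
      using zero[OF that(1)] zero[OF that(2)] m_le[of v] m_le[of u] \<open>m > 0\<close>
      by (auto simp: r_def of_bool_def)
    let ?cut = "real (card (edges_between G S (verts G - S)))"
    have "(\<Sum>v\<in>verts G. \<Sum>u\<in>neighbors G v. \<bar>q v - q u\<bar>) =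
        (\<Sum>v\<in>verts G. \<Sum>u\<in>neighbors G v. \<bar>r v - r u\<bar> + m * of_bool (v \<in> S \<and> u \<notin> S) + m * of_bool (u \<in> S \<and> v \<notin> S))"
      by (intro sum.cong refl abs_split) (auto dest: neighbors_in_verts)
    also have "\<dots> = (\<Sum>v\<in>verts G. \<Sum>u\<in>neighbors G v. \<bar>r v - r u\<bar>)
        + m * (\<Sum>v\<in>verts G. \<Sum>u\<in>neighbors G v. of_bool (v \<in> S \<and> u \<notin> S))
        + m * (\<Sum>v\<in>verts G. \<Sum>u\<in>neighbors G v. of_bool (u \<in> S \<and> v \<notin> S))"
      by (simp only: sum.distrib sum_distrib_left)
    also have "(\<Sum>v\<in>verts G. \<Sum>u\<in>neighbors G v. of_bool (u \<in> S \<and> v \<notin> S)) = ?cut"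
      by (subst sum_neighbors_swap) (rule sum_neighbors_indicator[OF S(1)])
    finally have lhs: "(\<Sum>v\<in>verts G. \<Sum>u\<in>neighbors G v. \<bar>q v - q u\<bar>) =
        (\<Sum>v\<in>verts G. \<Sum>u\<in>neighbors G v. \<bar>r v - r u\<bar>) + 2 * m * ?cut"
      by (simp only: sum_neighbors_indicator[OF S(1)] mult_2 distrib_right add.assoc)
    have "(\<Sum>v\<in>verts G. degree G v * q v) =
       (\<Sum>v\<in>verts G. degree G v * r v) + m * (\<Sum>v\<in>verts G. degree G v * of_bool (v \<in> S))"
      unfolding r_def by (simp add: algebra_simps sum.distrib sum_distrib_left sum_subtractf)
    also have "(\<Sum>v\<in>verts G. degree G v * of_bool (v \<in> S)) = vol G S"
      using S by (simp add: vol_def of_bool_def sum.inter_restrict[symmetric] finite_verts Int_absorb1 if_distrib cong: if_cong)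
    finally have rhs: "(\<Sum>v\<in>verts G. degree G v * q v) = (\<Sum>v\<in>verts G. degree G v * r v) + m * vol G S" .
    have "\<phi> * vol G S \<le> ?cut"
      using assms(1) S(1) less.prems(2) unfolding expands_def S_def[symmetric] by blast
    then have "2 * m * (\<phi> * vol G S) \<le> 2 * m * ?cut" using \<open>m > 0\<close> by simp
    with IH show ?thesis unfolding lhs rhs by (simp add: algebra_simps)
  qed
qed

text \<open>The coarea inequality is applied to the square of g. Factoring the difference of squares
  and applying Cauchy-Schwarz over ordered edges leaves the energy and the sum of
  \<open>(g v + g u)\<^sup>2\<close>, which is at most 4 times the norm.\<close>

lemma cheeger_half_support:
  assumes "expands \<phi>" "\<phi> \<ge> 0" "\<And>v. v \<in> verts G \<Longrightarrow> 0 \<le> g v"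
    and "2 * vol G {v \<in> verts G. g v > 0} \<le> vol G (verts G)"
  shows "\<phi>\<^sup>2 * deg_inner G g g \<le> energy G g"
proof -
  let ?E = "SIGMA v:verts G. neighbors G v"
  have pair: "(\<Sum>v\<in>verts G. \<Sum>u\<in>neighbors G v. F v u) = (\<Sum>(v, u)\<in>?E. F v u)" for F :: "'a \<Rightarrow> 'a \<Rightarrow> real"
    by (rule sum.Sigma) (simp_all add: finite_verts finite_neighbors)
  define D where "D = deg_inner G g g"
  have "{v \<in> verts G. (g v)\<^sup>2 > 0} = {v \<in> verts G. g v > 0}"
    using assms(3) by (auto simp: less_le)
  then have "2 * \<phi> * (\<Sum>v\<in>verts G. degree G v * (g v)\<^sup>2) \<le> (\<Sum>v\<in>verts G. \<Sum>u\<in>neighbors G v. \<bar>(g v)\<^sup>2 - (g u)\<^sup>2\<bar>)"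
    using assms by (intro coarea) auto
  also have "\<dots> = (\<Sum>v\<in>verts G. \<Sum>u\<in>neighbors G v. \<bar>g v - g u\<bar> * (g v + g u))"
    using assms(3) by (intro sum.cong refl)
      (auto simp: power2_eq_square square_diff_square_factored abs_mult dest!: neighbors_in_verts)
  finally have "2 * \<phi> * D \<le> (\<Sum>(v, u)\<in>?E. \<bar>g v - g u\<bar> * (g v + g u))" (is "_ \<le> ?X")
    by (simp add: D_def pair deg_inner_def power2_eq_square mult.assoc)
  moreover have "0 \<le> 2 * \<phi> * D" using assms(2) deg_inner_nonneg by (simp add: D_def)
  ultimately have "(2 * \<phi> * D)\<^sup>2 \<le> ?X\<^sup>2" by (intro power_mono)
  also have "?X = (\<Sum>e\<in>?E. \<bar>g (fst e) - g (snd e)\<bar> * (g (fst e) + g (snd e)))"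
    by (simp add: case_prod_unfold)
  also have "\<dots>\<^sup>2 \<le> (\<Sum>e\<in>?E. \<bar>g (fst e) - g (snd e)\<bar>\<^sup>2) * (\<Sum>e\<in>?E. (g (fst e) + g (snd e))\<^sup>2)"
    by (rule Cauchy_Schwarz_ineq_sum)
  also have "(\<Sum>e\<in>?E. \<bar>g (fst e) - g (snd e)\<bar>\<^sup>2) = energy G g"
    by (simp add: energy_def pair case_prod_unfold)
  also have "(\<Sum>e\<in>?E. (g (fst e) + g (snd e))\<^sup>2) \<le> 4 * D"
  proof -
    have "(\<Sum>e\<in>?E. (g (fst e) + g (snd e))\<^sup>2) = (\<Sum>v\<in>verts G. \<Sum>u\<in>neighbors G v. (g v + g u)\<^sup>2)"
      by (simp add: pair case_prod_unfold)
    also have "\<dots> \<le> (\<Sum>v\<in>verts G. \<Sum>u\<in>neighbors G v. 2 * (g v * g v) + 2 * (g u * g u))"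
    proof (intro sum_mono)
      fix u v
      show "(g v + g u)\<^sup>2 \<le> 2 * (g v * g v) + 2 * (g u * g u)"
        using zero_le_power2[of "g v - g u"] by (simp add: power2_eq_square algebra_simps)
    qed
    also have "\<dots> = 4 * D" unfolding D_def
      by (simp only: sum.distrib sum_distrib_left[of 2, symmetric]
          deg_inner_neighbors_left[symmetric] deg_inner_neighbors_right[symmetric])
    finally show ?thesis .
  qed
  finally have "(2 * \<phi> * D)\<^sup>2 \<le> energy G g * (4 * D)"
    by (simp add: energy_def sum_nonneg mult_left_mono)
  then have main: "4 * D * (\<phi>\<^sup>2 * D) \<le> 4 * D * energy G g"
    by (simp add: power2_eq_square mult_ac)
  show ?thesis
  proof (cases "D = 0")
    case True
    then show ?thesis by (simp add: D_def energy_def sum_nonneg)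
  next
    case False
    then have "D > 0" using deg_inner_nonneg[of g] by (simp add: D_def)
    then show ?thesis using main by (simp add: D_def)
  qed
qed

text \<open>Take for c the least value of f whose strict upper level set has at most half of the
  volume. If the strict lower level set were too large, the next smaller value would qualify as
  well.\<close>

lemma weighted_median:
  assumes "verts G \<noteq> {}"
  obtains c :: real where "2 * vol G {v \<in> verts G. f v > c} \<le> vol G (verts G)"
    "2 * vol G {v \<in> verts G. f v < c} \<le> vol G (verts G)"
proof -
  define C where "C = {x \<in> f ` verts G. 2 * vol G {v \<in> verts G. f v > x} \<le> vol G (verts G)}"
  have fin: "finite (f ` verts G)" using finite_verts by simp
  have empty: "{v \<in> verts G. f v > Max (f ` verts G)} = {}"
    using Max_ge[OF fin] by (auto simp: not_less)
  have "Max (f ` verts G) \<in> C"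
    unfolding C_def mem_Collect_eq empty using assms fin by (simp add: vol_def)
  then have C: "finite C" "C \<noteq> {}" using fin by (auto simp: C_def)
  define c where "c = Min C"
  have c: "c \<in> C" using C by (simp add: c_def)
  have "2 * vol G {v \<in> verts G. f v < c} \<le> vol G (verts G)"
  proof (rule ccontr)
    let ?L = "{v \<in> verts G. f v < c}"
    assume big: "\<not> ?thesis"
    then have ne: "?L \<noteq> {}" by (metis mult_0_right sum.empty vol_def zero_le)
    define b where "b = Max (f ` ?L)"
    have fL: "finite (f ` ?L)" using finite_verts by simp
    have b: "b \<in> f ` ?L" using ne fL by (simp add: b_def)
    have "{v \<in> verts G. f v > b} \<subseteq> verts G - ?L"
      using Max_ge[OF fL] by (force simp: b_def not_less)
    then have "vol G {v \<in> verts G. f v > b} \<le> vol G (verts G - ?L)"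
      by (rule vol_mono) simp
    also have "\<dots> = vol G (verts G) - vol G ?L" by (rule vol_Diff) auto
    finally have "2 * vol G {v \<in> verts G. f v > b} \<le> vol G (verts G)" using big by linarith
    then have "b \<in> C" using b by (auto simp: C_def)
    then have "c \<le> b" using C by (simp add: c_def)
    then show False using b by auto
  qed
  then show ?thesis using c that by (auto simp: C_def)
qed

text \<open>After a shift by a weighted median, the positive and the negative part are each
  supported on at most half of the volume. The shift does not decrease the norm, as f is orthogonal
  to constants. In view of the factor 4 in \<open>energy_eq\<close>, the spectral gap of W is at
  least \<phi>^2/4.\<close>

theorem cheeger:
  assumes "expands \<phi>" "\<phi> \<ge> 0" "verts G \<noteq> {}" "deg_inner G f (\<lambda>_. 1) = 0"
  shows "\<phi>\<^sup>2 * deg_inner G f f \<le> energy G f"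
proof -
  obtain c where c: "2 * vol G {v \<in> verts G. f v > c} \<le> vol G (verts G)"
    "2 * vol G {v \<in> verts G. f v < c} \<le> vol G (verts G)"
    using weighted_median[OF assms(3)] .
  define p n where "p v = max (f v - c) 0" and "n v = max (c - f v) 0" for v
  have "deg_inner G f f \<le> deg_inner G f f + c\<^sup>2 * vol G (verts G)" by simp
  also have "\<dots> = deg_inner G f f - 2 * c * deg_inner G f (\<lambda>_. 1) + c\<^sup>2 * vol G (verts G)"
    using assms(4) by simp
  also have "\<dots> = (\<Sum>v\<in>verts G. degree G v * (f v - c)\<^sup>2)"
    by (simp add: deg_inner_def vol_def algebra_simps power2_eq_square sum.distrib sum_subtractf sum_distrib_left)
  also have "\<dots> = deg_inner G p p + deg_inner G n n"
    unfolding deg_inner_def sum.distrib[symmetric]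
    by (intro sum.cong refl) (auto simp: p_def n_def max_def power2_eq_square algebra_simps)
  finally have "\<phi>\<^sup>2 * deg_inner G f f \<le> \<phi>\<^sup>2 * deg_inner G p p + \<phi>\<^sup>2 * deg_inner G n n"
    by (simp flip: distrib_left add: mult_left_mono)
  also have "\<phi>\<^sup>2 * deg_inner G p p \<le> energy G p"
    using assms c by (intro cheeger_half_support) (auto simp: p_def less_max_iff_disj)
  also have "\<phi>\<^sup>2 * deg_inner G n n \<le> energy G n"
    using assms c by (intro cheeger_half_support) (auto simp: n_def less_max_iff_disj)
  also have "energy G p + energy G n \<le> energy G f"
    unfolding energy_def sum.distrib[symmetric]
  proof (intro sum_mono)
    fix u v
    \<comment> \<open>As functions of the value of f, p is nondecreasing and n is nonincreasing, so
      the cross term has the favorable sign.\<close>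
    have "2 * ((p v - p u) * (n v - n u)) \<le> 0"
      by (auto simp: p_def n_def max_def mult_le_0_iff)
    moreover have "f v - f u = (p v - p u) - (n v - n u)" by (auto simp: p_def n_def max_def)
    ultimately show "(p v - p u)\<^sup>2 + (n v - n u)\<^sup>2 \<le> (f v - f u)\<^sup>2"
      by (simp only: power2_diff)
  qed
  finally show ?thesis by simp
qed

end

section \<open>Mixing, rounding and sparse cuts\<close>

text \<open>A single floor over the common denominator 2d keeps the error of a round below
  1.\<close>

definition rounded_walk :: "'a graph \<Rightarrow> ('a \<Rightarrow> nat) \<Rightarrow> 'a \<Rightarrow> nat" where
  "rounded_walk G x v = (degree G v * x v + (\<Sum>u\<in>neighbors G v. x u)) div (2 * degree G v)"

context positive_degree_graph
begin

text \<open>Degrees are at least 1, so norm at most 1 gives deviation at most 1 at every vertex. The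
  limit is the degree-weighted mean.\<close>

lemma lazy_walk_mixing:
  fixes R :: real
  assumes "expands \<phi>" "0 \<le> \<phi>" "\<phi> \<le> 1"
    and f: "\<And>v. v \<in> verts G \<Longrightarrow> 0 \<le> f v \<and> f v \<le> R"
    and small: "(1 - \<phi>\<^sup>2 / 4) ^ t * (vol G (verts G) * R\<^sup>2) \<le> 1" and v: "v \<in> verts G"
  shows "\<bar>(lazy_walk G ^^ t) f v - deg_inner G f (\<lambda>_. 1) / vol G (verts G)\<bar> \<le> 1"
proof -
  let ?m = "real (vol G (verts G))"
  define \<mu> where "\<mu> = deg_inner G f (\<lambda>_. 1) / ?m"
  define g where "g v = f v - \<mu>" for v
  have ne: "verts G \<noteq> {}" and m: "?m > 0" using v vol_pos by auto
  have inner_const: "deg_inner G (\<lambda>_. c) (\<lambda>_. 1) = c * ?m" for c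
    by (simp add: deg_inner_def vol_def sum_distrib_left mult.commute)
  have "deg_inner G g (\<lambda>_. 1) = deg_inner G f (\<lambda>_. 1) - deg_inner G (\<lambda>_. \<mu>) (\<lambda>_. 1)"
    by (simp add: g_def deg_inner_def algebra_simps sum_subtractf)
  then have g0: "deg_inner G g (\<lambda>_. 1) = 0"
    using m by (simp add: inner_const) (simp add: \<mu>_def)
  have lower: "0 \<le> deg_inner G f (\<lambda>_. 1)"
    unfolding deg_inner_def using f by (intro sum_nonneg) simp
  have upper: "deg_inner G f (\<lambda>_. 1) \<le> deg_inner G (\<lambda>_. R) (\<lambda>_. 1)"
    unfolding deg_inner_def using f by (intro sum_mono) (simp add: mult_left_mono)
  have \<mu>: "0 \<le> \<mu>" "\<mu> \<le> R"
    using lower upper m by (simp_all add: \<mu>_def inner_const field_simps)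
  have "deg_inner G g g \<le> (\<Sum>v\<in>verts G. real (degree G v) * R\<^sup>2)"
    unfolding deg_inner_def
  proof (rule sum_mono)
    fix v assume "v \<in> verts G"
    then have "\<bar>g v\<bar> \<le> \<bar>R\<bar>" using f[of v] \<mu> by (auto simp: g_def)
    then have "(g v)\<^sup>2 \<le> R\<^sup>2" by (simp add: abs_le_square_iff)
    then show "real (degree G v) * g v * g v \<le> real (degree G v) * R\<^sup>2"
      by (simp add: power2_eq_square mult.assoc mult_left_mono)
  qed
  then have gR: "deg_inner G g g \<le> ?m * R\<^sup>2" by (simp add: vol_def sum_distrib_right)
  have "\<phi>\<^sup>2 \<le> 1" using assms(2,3) by (simp add: power_le_one)
  then have "0 \<le> 1 - \<phi>\<^sup>2 / 4" by simp
  have "deg_inner G ((lazy_walk G ^^ t) g) ((lazy_walk G ^^ t) g) \<le> (1 - \<phi>\<^sup>2 / 4) ^ t * deg_inner G g g"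
    using \<open>\<phi>\<^sup>2 \<le> 1\<close> cheeger[OF assms(1,2) ne] g0 by (intro lazy_walk_contract) auto
  also have "\<dots> \<le> (1 - \<phi>\<^sup>2 / 4) ^ t * (?m * R\<^sup>2)"
    using gR \<open>0 \<le> 1 - \<phi>\<^sup>2 / 4\<close> by (intro mult_left_mono) auto
  finally have total: "deg_inner G ((lazy_walk G ^^ t) g) ((lazy_walk G ^^ t) g) \<le> 1"
    using small by linarith
  let ?w = "(lazy_walk G ^^ t) g v"
  have "1 * (?w * ?w) \<le> real (degree G v) * (?w * ?w)"
    using degree_pos[OF v] by (intro mult_right_mono) auto
  also have "\<dots> \<le> deg_inner G ((lazy_walk G ^^ t) g) ((lazy_walk G ^^ t) g)"
    unfolding deg_inner_def mult.assoc
    by (rule member_le_sum[OF v]) (simp_all add: finite_verts)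
  finally have "?w\<^sup>2 \<le> 1" using total by (simp add: power2_eq_square)
  then have "\<bar>?w\<bar> \<le> 1" by (simp add: abs_square_le_1)
  moreover have "?w = (lazy_walk G ^^ t) f v - \<mu>"
    unfolding g_def by (rule lazy_walk_pow_diff_const[OF v])
  ultimately show ?thesis by (simp add: \<mu>_def)
qed

lemma rounded_walk_bounds:
  assumes "v \<in> verts G"
  shows "real (rounded_walk G x v) \<le> lazy_walk G (\<lambda>u. real (x u)) v"
    "lazy_walk G (\<lambda>u. real (x u)) v \<le> real (rounded_walk G x v) + 1"
proof -
  define d where "d = degree G v"
  have d: "d > 0" using degree_pos[OF assms] by (simp add: d_def)
  have eq: "lazy_walk G (\<lambda>u. real (x u)) v = real (d * x v + (\<Sum>u\<in>neighbors G v. x u)) / real (2 * d)"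
    using d by (simp add: lazy_walk_def d_def[symmetric] field_simps)
  show "real (rounded_walk G x v) \<le> lazy_walk G (\<lambda>u. real (x u)) v"
    unfolding eq rounded_walk_def d_def[symmetric] by (rule of_nat_div_le_of_nat)
  show "lazy_walk G (\<lambda>u. real (x u)) v \<le> real (rounded_walk G x v) + 1"
    unfolding eq rounded_walk_def d_def[symmetric]
  proof (subst of_nat_of_nat_div_aux, rule add_left_mono)
    have "(d * x v + sum x (neighbors G v)) mod (2 * d) < 2 * d" using d by simp
    then show "real ((d * x v + sum x (neighbors G v)) mod (2 * d)) / real (2 * d) \<le> 1"
      using d by (simp only: divide_le_eq_1_pos of_nat_le_iff of_nat_0_less_iff)
  qed
qed

text \<open>W is monotone and fixes constants, so earlier errors are never amplified; each round
  adds at most 1, always in the same direction.\<close>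

lemma rounded_walk_pow_bounds:
  assumes "v \<in> verts G"
  shows "real ((rounded_walk G ^^ t) x v) \<le> (lazy_walk G ^^ t) (\<lambda>u. real (x u)) v"
    "(lazy_walk G ^^ t) (\<lambda>u. real (x u)) v \<le> real ((rounded_walk G ^^ t) x v) + t"
proof -
  have "real ((rounded_walk G ^^ t) x v) \<le> (lazy_walk G ^^ t) (\<lambda>u. real (x u)) v \<and>
     (lazy_walk G ^^ t) (\<lambda>u. real (x u)) v \<le> real ((rounded_walk G ^^ t) x v) + t"
    using assms
  proof (induction t arbitrary: v)
    case (Suc t)
    let ?r = "\<lambda>v. real ((rounded_walk G ^^ t) x v)" and ?l = "(lazy_walk G ^^ t) (\<lambda>u. real (x u))"
    have "lazy_walk G ?r v \<le> lazy_walk G ?l v"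
      by (rule lazy_walk_mono) (use Suc in blast)+
    moreover have "lazy_walk G ?l v \<le> lazy_walk G (\<lambda>v. ?r v + t) v"
      by (rule lazy_walk_mono) (use Suc in blast)+
    moreover have "\<dots> = lazy_walk G ?r v + t"
      using lazy_walk_diff_const[OF Suc.prems, of ?r "- real t"] by simp
    ultimately show ?case
      using rounded_walk_bounds[OF Suc.prems, of "(rounded_walk G ^^ t) x"] by simp
  qed simp
  then show "real ((rounded_walk G ^^ t) x v) \<le> (lazy_walk G ^^ t) (\<lambda>u. real (x u)) v"
    "(lazy_walk G ^^ t) (\<lambda>u. real (x u)) v \<le> real ((rounded_walk G ^^ t) x v) + t" by auto
qed

text \<open>Adjacency is symmetric, so no edge enters I either and W fixes its indicator.
  Self-adjointness turns this into conservation of the degree-weighted mass inside I.\<close>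

lemma lazy_walk_pow_closed_set:
  assumes closed: "\<And>v u. v \<in> I \<Longrightarrow> u \<in> neighbors G v \<Longrightarrow> u \<in> I"
  shows "deg_inner G ((lazy_walk G ^^ t) f) (\<lambda>v. of_bool (v \<in> I)) = deg_inner G f (\<lambda>v. of_bool (v \<in> I))"
proof (induction t)
  case (Suc t)
  let ?g = "(lazy_walk G ^^ t) f"
  have "lazy_walk G (\<lambda>v. of_bool (v \<in> I)) v = of_bool (v \<in> I)" if "v \<in> verts G" for v
  proof -
    have "(\<Sum>u\<in>neighbors G v. of_bool (u \<in> I)) = (\<Sum>u\<in>neighbors G v. of_bool (v \<in> I) :: real)"
      using closed neighbors_sym by (intro sum.cong) (auto simp: of_bool_def)
    then show ?thesis using degree_pos[OF that]
      by (simp add: lazy_walk_def degree_eq_card_neighbors)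
  qed
  then have "deg_inner G ?g (lazy_walk G (\<lambda>v. of_bool (v \<in> I))) = deg_inner G ?g (\<lambda>v. of_bool (v \<in> I))"
    unfolding deg_inner_def by (intro sum.cong) auto
  with Suc show ?case by (simp add: lazy_walk_self_adjoint)
qed simp

text \<open>The set of vertices whose value is within k \<tau> of \<open>f w\<close> gains a vertex
  with every k until it is everything, since some edge leaves it.\<close>

lemma spread_bound:
  fixes f :: "'a \<Rightarrow> real" and \<tau> :: real
  assumes conn: "\<And>S. S \<noteq> {} \<Longrightarrow> S \<subset> verts G \<Longrightarrow> \<exists>v\<in>S. \<exists>u\<in>neighbors G v. u \<notin> S"
    and close: "\<And>v u. v \<in> verts G \<Longrightarrow> u \<in> neighbors G v \<Longrightarrow> \<bar>f u - f v\<bar> \<le> \<tau>"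
    and "v \<in> verts G" "w \<in> verts G"
  shows "\<bar>f v - f w\<bar> \<le> card (verts G) * \<tau>"
proof -
  define A where "A k = {v \<in> verts G. \<bar>f v - f w\<bar> \<le> real k * \<tau>}" for k
  obtain w' where "w' \<in> neighbors G w"
    using degree_pos[OF assms(4)] by (metis card.empty degree_eq_card_neighbors ex_in_conv less_irrefl)
  then have "\<tau> \<ge> 0" using close[OF assms(4)] by force
  have "A k = verts G \<or> k < card (A k)" for k
  proof (induction k)
    case 0
    have "w \<in> A 0" using assms(4) by (simp add: A_def)
    then show ?case using finite_verts by (auto simp: A_def card_gt_0_iff)
  next
    case (Suc k)
    have sub: "A k \<subseteq> A (Suc k)"
      using \<open>\<tau> \<ge> 0\<close> by (auto simp: A_def algebra_simps)
    have top: "A j \<subseteq> verts G" for j by (auto simp: A_def)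
    show ?case
    proof (cases "A k = verts G")
      case True
      then show ?thesis using sub top[of "Suc k"] by auto
    next
      case False
      then obtain v u where "v \<in> A k" "u \<in> neighbors G v" "u \<notin> A k"
        using conn[of "A k"] Suc top[of k] by fastforce
      moreover from this have "u \<in> A (Suc k)"
        using close[of v u] neighbors_in_verts[of u v] by (auto simp: A_def algebra_simps)
      ultimately have "card (A k) < card (A (Suc k))"
        using sub top finite_verts by (intro psubset_card_mono) (auto intro: finite_subset)
      then show ?thesis using Suc False by auto
    qed
  qed
  moreover have "card (A (card (verts G))) \<le> card (verts G)"
    using finite_verts by (intro card_mono) (auto simp: A_def)
  ultimately have "A (card (verts G)) = verts G" by (meson not_le)
  then show ?thesis using assms(3) by (auto simp: A_def)
qed

text \<open>The functional is \<open>f \<mapsto> \<langle>W\<^sup>t h, f\<rangle> = \<langle>h, W\<^sup>t f\<rangle>\<close> for the centered indicator function \<open>h\<close> of \<open>S\<close>.\<close>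
lemma sparse_cut_functional:
  fixes \<delta> :: real
  assumes S: "S \<noteq> {}" "S \<subseteq> verts G" "2 * vol G S \<le> vol G (verts G)"
    and cut: "card (edges_between G S (verts G - S)) \<le> \<delta> * vol G S" and \<delta>: "\<delta> \<le> 1"
  obtains \<gamma> :: "'a \<Rightarrow> real" and v where "v \<in> verts G" "(1 - \<delta>) ^ t / (2 * card (verts G)) \<le> \<bar>\<gamma> v\<bar>"
    "\<And>f (c :: real) (\<rho> :: real). (\<And>v. v \<in> verts G \<Longrightarrow> \<bar>(lazy_walk G ^^ t) f v - c\<bar> \<le> \<rho>) \<Longrightarrow>
      \<bar>\<Sum>v\<in>verts G. \<gamma> v * f v\<bar> \<le> vol G (verts G) * \<rho>"
proof -
  let ?m = "real (vol G (verts G))" and ?s = "real (vol G S)" and ?n = "real (card (verts G))"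
  have ne: "verts G \<noteq> {}" using S by auto
  then have m: "?m > 0" using vol_pos by simp
  obtain w where "w \<in> S" using S by auto
  moreover have "finite S" using S finite_verts finite_subset by auto
  ultimately have "degree G w \<le> vol G S" unfolding vol_def by (intro member_le_sum) auto
  then have s: "?s \<ge> 1" using degree_pos[of w] \<open>w \<in> S\<close> S by force
  \<comment> \<open>This is the degree-weighted mean of the indicator of S. Half volume gives p
    \<le> 1/2, so centering costs at most half of the norm.\<close>
  define p where "p = ?s / ?m"
  have p: "0 \<le> p" "p \<le> 1 / 2" "p * ?m = ?s"
    using S(3) m by (auto simp: p_def field_simps)
  define h where "h v = of_bool (v \<in> S) - p" for v
  have h1: "\<bar>h v\<bar> \<le> 1" for v using p by (auto simp: h_def)
  have ind: "(\<Sum>v\<in>verts G. real (degree G v) * of_bool (v \<in> S)) = ?s"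
    using S by (simp add: vol_def of_bool_def sum.inter_restrict[symmetric] finite_verts Int_absorb1 if_distrib cong: if_cong)
  have "deg_inner G h (\<lambda>_. 1) = (\<Sum>v\<in>verts G. real (degree G v) * of_bool (v \<in> S)) - p * ?m"
    by (simp add: deg_inner_def h_def algebra_simps sum_subtractf vol_def sum_distrib_left del: sum_mult_of_bool_eq)
  then have h0: "deg_inner G h (\<lambda>_. 1) = 0" unfolding ind p(3) by simp
  have "deg_inner G h h = (\<Sum>v\<in>verts G. real (degree G v) * of_bool (v \<in> S) * (1 - p)) - p * deg_inner G h (\<lambda>_. 1)"
    unfolding deg_inner_def h_def sum_distrib_left sum_subtractf[symmetric]
    by (intro sum.cong) (auto simp: algebra_simps)
  then have hh: "deg_inner G h h = ?s * (1 - p)"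
    unfolding h0 sum_distrib_right[symmetric] ind by simp
  have hs: "?s \<le> 2 * deg_inner G h h" using p s unfolding hh by (simp add: field_simps)
  have "energy G h = (\<Sum>v\<in>verts G. \<Sum>u\<in>neighbors G v. of_bool (v \<in> S \<and> u \<notin> S) + of_bool (u \<in> S \<and> v \<notin> S))"
    unfolding energy_def h_def by (intro sum.cong) auto
  also have "\<dots> = 2 * real (card (edges_between G S (verts G - S)))"
    unfolding sum.distrib sum_neighbors_indicator[OF S(2), symmetric]
    by (subst (2) sum_neighbors_swap) simp
  finally have "energy G h \<le> 2 * (\<delta> * ?s)" using cut by simp
  moreover have "\<delta> \<ge> 0" using cut s by (smt (verit) of_nat_0_le_iff zero_le_mult_iff)
  then have "\<delta> * ?s \<le> \<delta> * (2 * deg_inner G h h)" using hs by (rule mult_left_mono[rotated])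
  \<comment> \<open>Both orientations of a cut edge and the factor 2 in \<open>hs\<close> together
    match the 4 in \<open>energy_eq\<close>.\<close>
  ultimately have "(1 - \<delta>) * deg_inner G h h \<le> deg_inner G h (lazy_walk G h)"
    unfolding energy_eq lazy_walk_self_adjoint by (simp add: algebra_simps)
  then have "(1 - \<delta>) ^ t * deg_inner G h h \<le> deg_inner G h ((lazy_walk G ^^ t) h)"
    using \<delta> by (intro lazy_walk_moment_ge) auto
  moreover have "(1 - \<delta>) ^ t * (1 / 2) \<le> (1 - \<delta>) ^ t * deg_inner G h h"
    using hs s \<delta> by (intro mult_left_mono) auto
  ultimately have a: "(1 - \<delta>) ^ t / 2 \<le> deg_inner G h ((lazy_walk G ^^ t) h)" by simp
  define \<gamma> where "\<gamma> v = degree G v * (lazy_walk G ^^ t) h v" for v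
  \<comment> \<open>As |h| \<le> 1, the absolute values of \<gamma> add up to at least (1 -
    \<delta>)^t / 2, and some vertex reaches the average.\<close>
  have "\<exists>v\<in>verts G. (1 - \<delta>) ^ t / (2 * ?n) \<le> \<bar>\<gamma> v\<bar>"
  proof (rule ccontr)
    assume "\<not> ?thesis"
    then have less: "\<bar>\<gamma> v\<bar> < (1 - \<delta>) ^ t / (2 * ?n)" if "v \<in> verts G" for v using that by force
    have "deg_inner G h ((lazy_walk G ^^ t) h) \<le> (\<Sum>v\<in>verts G. \<bar>\<gamma> v\<bar>)"
      unfolding deg_inner_def
    proof (rule sum_mono)
      fix v
      have "real (degree G v) * h v * (lazy_walk G ^^ t) h v = h v * \<gamma> v" by (simp add: \<gamma>_def)
      also have "\<dots> \<le> \<bar>h v\<bar> * \<bar>\<gamma> v\<bar>" by (metis abs_ge_self abs_mult)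
      also have "\<dots> \<le> \<bar>\<gamma> v\<bar>" using h1 by (simp add: mult_left_le_one_le)
      finally show "real (degree G v) * h v * (lazy_walk G ^^ t) h v \<le> \<bar>\<gamma> v\<bar>" .
    qed
    also have "\<dots> < (\<Sum>v\<in>verts G. (1 - \<delta>) ^ t / (2 * ?n))"
      using less ne finite_verts by (intro sum_strict_mono) auto
    also have "\<dots> = (1 - \<delta>) ^ t / 2" using ne finite_verts by simp
    finally show False using a by simp
  qed
  then obtain v where v: "v \<in> verts G" "(1 - \<delta>) ^ t / (2 * card (verts G)) \<le> \<bar>\<gamma> v\<bar>" by auto
  have bound: "\<bar>\<Sum>v\<in>verts G. \<gamma> v * f v\<bar> \<le> ?m * \<rho>"
    if close: "\<And>v. v \<in> verts G \<Longrightarrow> \<bar>(lazy_walk G ^^ t) f v - c\<bar> \<le> \<rho>" for f \<rho> and c :: real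
  proof -
    have "(\<Sum>v\<in>verts G. \<gamma> v * f v) = deg_inner G ((lazy_walk G ^^ t) h) f"
      by (simp add: \<gamma>_def deg_inner_def)
    also have "\<dots> = deg_inner G h ((lazy_walk G ^^ t) f) - c * deg_inner G h (\<lambda>_. 1)"
      by (simp add: h0 lazy_walk_pow_self_adjoint)
    also have "\<dots> = (\<Sum>v\<in>verts G. degree G v * (h v * ((lazy_walk G ^^ t) f v - c)))"
      by (simp add: deg_inner_def sum_distrib_left sum_subtractf[symmetric] algebra_simps)
    also have "\<bar>\<dots>\<bar> \<le> (\<Sum>v\<in>verts G. degree G v * \<rho>)"
    proof (rule order_trans[OF sum_abs], rule sum_mono)
      fix v assume "v \<in> verts G"
      then have "\<bar>h v\<bar> * \<bar>(lazy_walk G ^^ t) f v - c\<bar> \<le> 1 * \<rho>"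
        using h1 close by (intro mult_mono) auto
      then show "\<bar>degree G v * (h v * ((lazy_walk G ^^ t) f v - c))\<bar> \<le> degree G v * \<rho>"
        by (simp add: abs_mult mult_left_mono)
    qed
    also have "\<dots> = ?m * \<rho>" by (simp add: vol_def sum_distrib_right)
    finally show ?thesis .
  qed
  show ?thesis by (rule that[OF v bound])
qed

end

section \<open>Anticoncentration of a linear functional of independent seeds\<close>

lemma prob_Pi_pmf_le:
  assumes "finite V" "v \<in> V" and le: "\<And>f. measure_pmf.prob (p v) {y. f(v := y) \<in> E} \<le> b"
  shows "measure_pmf.prob (Pi_pmf V d p) E \<le> b"
proof -
  define V' where "V' = V - {v}"
  have V: "V = insert v V'" "v \<notin> V'" "finite V'" using assms by (auto simp: V'_def)
  have "Pi_pmf V d p = bind_pmf (Pi_pmf V' d p) (\<lambda>f. map_pmf (\<lambda>y. f(v := y)) (p v))"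
    unfolding V(1) using V by (simp add: Pi_pmf_insert' map_pmf_def bind_commute_pmf[of "p v"])
  then have "measure_pmf.prob (Pi_pmf V d p) E =
     (\<integral>f. measure_pmf.prob (p v) {y. f(v := y) \<in> E} \<partial>measure_pmf (Pi_pmf V' d p))"
    by (simp add: measure_pmf_bind measure_pmf.measure_bind[where N = "count_space UNIV"] measure_subprob vimage_def)
  also have "\<dots> \<le> (\<integral>f. b \<partial>measure_pmf (Pi_pmf V' d p))"
    using le by (intro integral_mono[OF measure_pmf.integrable_const_bound[where B = 1]]) auto
  finally show ?thesis by simp
qed

text \<open>The three values are spaced by |\<gamma>| \<ge> 2r, and an open interval of length 2r
  contains at most one of them. Seeds from a set of three thus yield the error 1/3.\<close>

lemma prob_small_affine_le:
  fixes \<gamma> c :: real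
  assumes "2 * r \<le> \<bar>\<gamma>\<bar>"
  shows "measure_pmf.prob (pmf_of_set {..<3::nat}) {y. \<bar>\<gamma> * real y + c\<bar> < r} \<le> 1 / 3"
proof -
  have "card ({..<3} \<inter> {y::nat. \<bar>\<gamma> * real y + c\<bar> < r}) \<le> 1"
  proof (rule card_le_Suc0_iff_eq[THEN iffD2, unfolded One_nat_def[symmetric]])
    show "\<forall>x\<in>{..<3} \<inter> {y::nat. \<bar>\<gamma> * real y + c\<bar> < r}. \<forall>y\<in>{..<3} \<inter> {y::nat. \<bar>\<gamma> * real y + c\<bar> < r}. x = y"
    proof (intro ballI, rule ccontr)
      fix x y assume xy: "x \<in> {..<3} \<inter> {y::nat. \<bar>\<gamma> * real y + c\<bar> < r}"
        "y \<in> {..<3} \<inter> {y::nat. \<bar>\<gamma> * real y + c\<bar> < r}" "x \<noteq> y"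
      then have "\<bar>real x - real y\<bar> \<ge> 1" by linarith
      then have "\<bar>\<gamma>\<bar> * 1 \<le> \<bar>\<gamma>\<bar> * \<bar>real x - real y\<bar>" by (intro mult_left_mono) auto
      also have "\<dots> = \<bar>(\<gamma> * real x + c) - (\<gamma> * real y + c)\<bar>"
        by (simp add: abs_mult[symmetric] algebra_simps)
      also have "\<dots> < 2 * r" using xy by auto
      finally show False using assms by simp
    qed
  qed simp
  then show ?thesis by (simp add: measure_pmf_of_set lessThan_empty_iff)
qed

section \<open>The acceptance condition\<close>

definition flood_step :: "'a graph \<Rightarrow> ('a \<Rightarrow> nat) \<Rightarrow> 'a \<Rightarrow> nat" where
  "flood_step G x v = Min (insert (x v) (x ` neighbors G v))"

text \<open>Dividing by the degree turns the charges -1 and n into degree-weighted masses. The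
  offset Q makes them natural numbers; the subtraction never truncates, because
  \<open>Q div d \<le> Q\<close>.\<close>

definition leader_start :: "'a graph \<Rightarrow> ('a \<Rightarrow> nat) \<Rightarrow> nat \<Rightarrow> nat \<Rightarrow> 'a \<Rightarrow> nat" where
  "leader_start G i T Q v =
     Q + (if (flood_step G ^^ T) i v = i v then card (verts G) * Q div degree G v else 0) - Q div degree G v"

definition random_start :: "nat \<Rightarrow> ('a \<Rightarrow> nat) \<Rightarrow> 'a \<Rightarrow> nat" where
  "random_start Q \<zeta> v = \<zeta> v * Q"

text \<open>The tolerance is the total rounding loss T plus 2: in the first test for mixing and for
  the floors in \<open>leader_start\<close>, in the second for the mixing error at both ends of an
  edge.\<close>

definition accepts :: "'a graph \<Rightarrow> ('a \<Rightarrow> nat) \<Rightarrow> nat \<Rightarrow> nat \<Rightarrow> ('a \<Rightarrow> nat) \<Rightarrow> 'a \<Rightarrow> bool" where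
  "accepts G i T Q \<zeta> v \<longleftrightarrow> degree G v > 0 \<and>
     \<bar>int ((rounded_walk G ^^ T) (leader_start G i T Q) v) - int Q\<bar> \<le> int T + 2 \<and>
     (\<forall>u\<in>neighbors G v. \<bar>int ((rounded_walk G ^^ T) (random_start Q \<zeta>) v) -
        int ((rounded_walk G ^^ T) (random_start Q \<zeta>) u)\<bar> \<le> int T + 2)"

context finite_graph
begin

lemma flood_step_le_iff: "flood_step G x v \<le> a \<longleftrightarrow> x v \<le> a \<or> (\<exists>u\<in>neighbors G v. x u \<le> a)"
  unfolding flood_step_def using finite_neighbors by (subst Min_le_iff) auto

lemma flood_step_ge_iff: "a \<le> flood_step G x v \<longleftrightarrow> a \<le> x v \<and> (\<forall>u\<in>neighbors G v. a \<le> x u)"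
  unfolding flood_step_def using finite_neighbors by (subst Min_ge_iff) auto

lemma flood_le: "(flood_step G ^^ t) x v \<le> x v"
proof (induction t)
  case (Suc t)
  then show ?case by (simp add: flood_step_le_iff)
qed simp

lemma flood_ge_closed:
  assumes closed: "\<And>v u. v \<in> I \<Longrightarrow> u \<in> neighbors G v \<Longrightarrow> u \<in> I" and "\<And>v. v \<in> I \<Longrightarrow> a \<le> x v" "v \<in> I"
  shows "a \<le> (flood_step G ^^ t) x v"
  using assms(3)
proof (induction t arbitrary: v)
  case (Suc t)
  then show ?case using closed by (auto simp: flood_step_ge_iff)
qed (simp add: assms(2))

lemma rounded_walk_le:
  assumes "\<And>v. v \<in> verts G \<Longrightarrow> x v \<le> R" "v \<in> verts G"
  shows "rounded_walk G x v \<le> R"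
proof -
  have "(\<Sum>u\<in>neighbors G v. x u) \<le> degree G v * R"
    unfolding degree_eq_card_neighbors
    by (rule sum_bounded_above[of _ _ R, simplified]) (auto intro: assms(1) neighbors_in_verts)
  moreover have "degree G v * x v \<le> degree G v * R" using assms by simp
  ultimately have "degree G v * x v + (\<Sum>u\<in>neighbors G v. x u) \<le> 2 * degree G v * R" by linarith
  then have "rounded_walk G x v \<le> 2 * degree G v * R div (2 * degree G v)"
    unfolding rounded_walk_def by (rule div_le_mono)
  then show ?thesis by (cases "degree G v = 0") auto
qed

lemma rounded_walk_pow_le:
  assumes "\<And>v. v \<in> verts G \<Longrightarrow> x v \<le> R" "v \<in> verts G"
  shows "(rounded_walk G ^^ t) x v \<le> R"
  using assms(2) by (induction t arbitrary: v) (auto intro: assms(1) rounded_walk_le)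

lemma leader_start_le: "leader_start G i T Q v \<le> Q + card (verts G) * Q"
  unfolding leader_start_def by (auto intro: order_trans[OF diff_le_self] div_le_dividend)

end

context positive_degree_graph
begin

text \<open>A quotient by d, rounded down and multiplied back, falls short by less than d. The floor
  of the negative charge yields the error in the upper bound, that of the leader's charge the error
  in the lower one.\<close>

lemma leader_start_mass:
  fixes i :: "'a \<Rightarrow> nat" and T Q :: nat
  assumes "v \<in> verts G"
  defines "L \<equiv> (flood_step G ^^ T) i v = i v"
  shows "degree G v * real (leader_start G i T Q v) \<ge> degree G v * real Q - Q + of_bool L * (card (verts G) * Q - real (degree G v))"
    and "degree G v * real (leader_start G i T Q v) \<le> degree G v * real Q - Q + degree G v + of_bool L * (card (verts G) * Q)"
proof -
  define d where "d = degree G v"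
  define n where "n = card (verts G)"
  have d: "d > 0" using degree_pos assms by (simp add: d_def)
  have "Q div d \<le> Q + x" for x by (simp add: trans_le_add1)
  then have start: "real (leader_start G i T Q v) = Q + of_bool L * real (n * Q div d) - real (Q div d)"
    by (simp add: leader_start_def L_def n_def d_def of_nat_diff)
  have eq: "d * real (leader_start G i T Q v) = d * real Q + of_bool L * real (d * (n * Q div d)) - real (d * (Q div d))"
    unfolding start by (cases L) (simp_all add: right_diff_distrib distrib_left)
  have split: "d * (x div d) + x mod d = x" "x mod d < d" for x using d by auto
  have lo: "real x - d \<le> real (d * (x div d))" for x
    using split[of x] by linarith
  have hi: "real (d * (x div d)) \<le> real x" for x
    using split[of x] by linarith
  show "degree G v * real (leader_start G i T Q v) \<ge> degree G v * real Q - Q + of_bool L * (card (verts G) * Q - real (degree G v))"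
    unfolding d_def[symmetric] n_def[symmetric] eq using lo[of "n * Q"] hi[of Q] by (cases L) auto
  show "degree G v * real (leader_start G i T Q v) \<le> degree G v * real Q - Q + degree G v + of_bool L * (card (verts G) * Q)"
    unfolding d_def[symmetric] n_def[symmetric] eq using hi[of "n * Q"] lo[of Q] by (cases L) auto
qed

text \<open>Walk mass and identifiers travel along the same edges. Hence mixing of a point mass
  shows that flooding has reached everyone, and no separate bound on the diameter is
  required.\<close>

lemma flood_reaches_support:
  assumes "(lazy_walk G ^^ t) (\<lambda>v. c * of_bool (v = w)) v > 0" "v \<in> verts G" "c \<ge> 0"
  shows "(flood_step G ^^ t) i v \<le> i w"
  using assms(1,2)
proof (induction t arbitrary: v)
  case 0
  then show ?case by (auto split: if_splits simp: of_bool_def)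
next
  case (Suc t)
  let ?f = "(lazy_walk G ^^ t) (\<lambda>v. c * of_bool (v = w))"
  have "?f v > 0 \<or> (\<exists>u\<in>neighbors G v. ?f u > 0)"
  proof (rule ccontr)
    assume "\<not> ?thesis"
    then have "?f v \<le> 0" "sum ?f (neighbors G v) \<le> 0"
      by (auto intro!: sum_nonpos simp: not_less)
    then have "?f v + sum ?f (neighbors G v) / degree G v \<le> 0"
      by (intro add_nonpos_nonpos divide_nonpos_nonneg) auto
    then have "lazy_walk G ?f v \<le> 0" by (subst lazy_walk_def) simp
    then show False using Suc.prems by simp
  qed
  then have "(flood_step G ^^ t) i v \<le> i w \<or> (\<exists>u\<in>neighbors G v. (flood_step G ^^ t) i u \<le> i w)"
    using Suc neighbors_in_verts by blast
  then show ?case by (simp add: flood_step_le_iff)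
qed

lemma accepts_if_expands:
  fixes Q T :: nat
  assumes exp: "expands \<phi>" "0 \<le> \<phi>" "\<phi> \<le> 1"
    and inj: "inj_on i (verts G)" and n: "card (verts G) \<ge> 2" and Q: "(card (verts G))\<^sup>2 \<le> Q"
    and mix: "(1 - \<phi>\<^sup>2 / 4) ^ T * ((card (verts G))\<^sup>2 * (2 * card (verts G) * real Q)\<^sup>2) \<le> 1"
    and \<zeta>: "\<And>v. v \<in> verts G \<Longrightarrow> \<zeta> v \<le> 2" and v: "v \<in> verts G"
  shows "accepts G i T Q \<zeta> v"
proof -
  define n where "n = card (verts G)"
  let ?m = "real (vol G (verts G))"
  define R where "R = 2 * n * real Q"
  have ne: "verts G \<noteq> {}" using v by auto
  have m: "?m > 0" "?m \<le> n\<^sup>2" using vol_pos[OF ne] vol_le n_def by (auto simp flip: of_nat_power)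
  have "\<phi>\<^sup>2 \<le> 1" using exp by (simp add: power_le_one)
  then have "(1 - \<phi>\<^sup>2 / 4) ^ T * (?m * R\<^sup>2) \<le> (1 - \<phi>\<^sup>2 / 4) ^ T * (n\<^sup>2 * R\<^sup>2)"
    using m by (intro mult_left_mono mult_right_mono) auto
  then have small: "(1 - \<phi>\<^sup>2 / 4) ^ T * (?m * R\<^sup>2) \<le> 1" using mix by (simp add: R_def n_def)
  note mixing = lazy_walk_mixing[OF exp _ small]
  have n2: "2 \<le> n" using n by (simp add: n_def)
  \<comment> \<open>Floors only lose, so the integer lies between \<mu> - T - 1 and \<mu> + 1; two
    such integers differ by at most T + 2.\<close>
  have rounded: "\<bar>real ((rounded_walk G ^^ T) x u) - (\<mu> - T / 2)\<bar> \<le> T / 2 + 1"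
    if "\<mu> = deg_inner G (\<lambda>u. real (x u)) (\<lambda>_. 1) / ?m" "\<And>u. u \<in> verts G \<Longrightarrow> real (x u) \<le> R" "u \<in> verts G" for x \<mu> u
  proof -
    have "\<bar>(lazy_walk G ^^ T) (\<lambda>u. real (x u)) u - \<mu>\<bar> \<le> 1"
      unfolding that(1) by (rule mixing) (use that in auto)
    then show ?thesis using rounded_walk_pow_bounds[OF that(3), of T x] by (simp add: abs_le_iff)
  qed
  obtain w where w: "w \<in> verts G" "\<And>u. u \<in> verts G \<Longrightarrow> i w \<le> i u"
    using ex_min_if_finite[of "i ` verts G"] finite_verts ne by (force simp: not_less)
  have leader: "(flood_step G ^^ T) i u = i u \<longleftrightarrow> u = w" if u: "u \<in> verts G" for u
  proof
    \<comment> \<open>Height n^3 makes the mean at least n \<ge> 2, above the mixing error 1, so the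
      walk is positive everywhere. It is admissible as n^2 \<le> Q.\<close>
    define f where "f u = real n ^ 3 * of_bool (u = w)" for u
    have "n ^ 3 \<le> 2 * n * Q" using Q mult_le_mono2[of "n\<^sup>2" Q n] by (simp add: n_def power3_eq_cube power2_eq_square)
    then have "real n ^ 3 \<le> R" unfolding R_def by (metis of_nat_le_iff of_nat_mult of_nat_numeral of_nat_power)
    moreover have "0 \<le> R" by (simp add: R_def)
    ultimately have "0 \<le> f v \<and> f v \<le> R" for v by (simp add: f_def)
    then have mu: "\<bar>(lazy_walk G ^^ T) f u - deg_inner G f (\<lambda>_. 1) / ?m\<bar> \<le> 1"
      by (intro mixing u) auto
    have "deg_inner G f (\<lambda>_. 1) = (\<Sum>u\<in>verts G. if w = u then degree G u * real n ^ 3 else 0)"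
      unfolding deg_inner_def f_def by (intro sum.cong) auto
    then have "deg_inner G f (\<lambda>_. 1) = degree G w * real n ^ 3"
      using w(1) finite_verts by simp
    then have "real n ^ 3 \<le> deg_inner G f (\<lambda>_. 1)" using degree_pos[OF w(1)] n2 by simp
    then have "real n ^ 3 / ?m \<le> deg_inner G f (\<lambda>_. 1) / ?m" by (intro divide_right_mono) auto
    moreover have "real n ^ 3 / real n ^ 2 \<le> real n ^ 3 / ?m"
      using m n2 by (intro divide_left_mono) (auto simp flip: of_nat_power)
    moreover have "real n ^ 3 / real n ^ 2 = n" by (simp add: power3_eq_cube power2_eq_square)
    ultimately have "deg_inner G f (\<lambda>_. 1) / ?m \<ge> 2" using n2 by simp
    then have "(lazy_walk G ^^ T) f u > 0" using mu by (simp add: abs_le_iff)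
    then have "(flood_step G ^^ T) i u \<le> i w"
      unfolding f_def using u by (intro flood_reaches_support) auto
    moreover assume "(flood_step G ^^ T) i u = i u"
    ultimately have "i u = i w" using w(2)[OF u] by simp
    then show "u = w" using inj u w(1) by (simp add: inj_on_def)
  next
    assume "u = w"
    moreover have "i w \<le> (flood_step G ^^ T) i w"
      by (rule flood_ge_closed[of "verts G"]) (use w neighbors_in_verts in auto)
    ultimately show "(flood_step G ^^ T) i u = i u" using flood_le[of T i w] by simp
  qed
  let ?x = "leader_start G i T Q"
  define \<mu> where "\<mu> = deg_inner G (\<lambda>u. real (?x u)) (\<lambda>_. 1) / ?m"
  have single: "(\<Sum>u\<in>verts G. of_bool ((flood_step G ^^ T) i u = i u) * F u) = (F w :: real)" for F
  proof -
    have "(\<Sum>u\<in>verts G. of_bool ((flood_step G ^^ T) i u = i u) * F u) = (\<Sum>u\<in>verts G. if w = u then F u else 0)"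
      using leader by (intro sum.cong) auto
    then show ?thesis using w(1) finite_verts by simp
  qed
  have "(\<Sum>u\<in>verts G. degree G u * real Q - Q + of_bool ((flood_step G ^^ T) i u = i u) * (n * real Q - real (degree G u)))
     \<le> deg_inner G (\<lambda>u. real (?x u)) (\<lambda>_. 1)"
    unfolding deg_inner_def n_def using leader_start_mass(1) by (intro sum_mono) simp
  moreover have "deg_inner G (\<lambda>u. real (?x u)) (\<lambda>_. 1) \<le>
     (\<Sum>u\<in>verts G. degree G u * real Q - Q + degree G u + of_bool ((flood_step G ^^ T) i u = i u) * (n * real Q))"
    unfolding deg_inner_def n_def using leader_start_mass(2) by (intro sum_mono) simp
  moreover have vq: "(\<Sum>u\<in>verts G. degree G u * real Q) = ?m * Q" "(\<Sum>u\<in>verts G. real (degree G u)) = ?m"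
    by (simp_all add: vol_def sum_distrib_right)
  moreover have "degree G w \<le> vol G (verts G)"
    unfolding vol_def using w(1) finite_verts by (intro member_le_sum) auto
  then have "degree G w \<le> ?m" by simp
  \<comment> \<open>With one leader the charge n Q cancels the n charges -Q, and only the floors
    remain.\<close>
  ultimately have "?m * Q - ?m \<le> deg_inner G (\<lambda>u. real (?x u)) (\<lambda>_. 1)" "deg_inner G (\<lambda>u. real (?x u)) (\<lambda>_. 1) \<le> ?m * Q + ?m"
    unfolding sum.distrib sum_subtractf single vq by (simp_all add: n_def)
  then have "\<bar>\<mu> - Q\<bar> \<le> 1" using m(1) by (simp add: \<mu>_def field_simps abs_le_iff)
  moreover have "real (?x u) \<le> R" for u
  proof -
    have "?x u \<le> Q + n * Q" unfolding n_def by (rule leader_start_le)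
    also have "\<dots> \<le> 2 * n * Q" using n2 by (cases n) auto
    finally show ?thesis unfolding R_def by (metis of_nat_le_iff of_nat_mult of_nat_numeral)
  qed
  ultimately have "\<bar>real ((rounded_walk G ^^ T) ?x v) - Q\<bar> \<le> T + 2"
    using rounded[OF \<mu>_def _ v] by (simp add: abs_le_iff)
  then have 1: "\<bar>int ((rounded_walk G ^^ T) ?x v) - int Q\<bar> \<le> int T + 2"
    by linarith
  have zR: "real (random_start Q \<zeta> u) \<le> R" if "u \<in> verts G" for u
  proof -
    have "random_start Q \<zeta> u \<le> 2 * n * Q"
      unfolding random_start_def using \<zeta>[OF that] n2 by (intro mult_right_mono) auto
    then show ?thesis unfolding R_def by (metis of_nat_le_iff of_nat_mult of_nat_numeral)
  qed
  define \<mu>z where "\<mu>z = deg_inner G (\<lambda>u. real (random_start Q \<zeta> u)) (\<lambda>_. 1) / ?m"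
  have rz: "\<bar>real ((rounded_walk G ^^ T) (random_start Q \<zeta>) u) - (\<mu>z - T / 2)\<bar> \<le> T / 2 + 1"
    if "u \<in> verts G" for u
    by (rule rounded[OF \<mu>z_def _ that]) (rule zR)
  have 2: "\<bar>int ((rounded_walk G ^^ T) (random_start Q \<zeta>) v) - int ((rounded_walk G ^^ T) (random_start Q \<zeta>) u)\<bar> \<le> int T + 2"
    if "u \<in> neighbors G v" for u
  proof -
    have u: "u \<in> verts G" using that by (rule neighbors_in_verts)
    have "\<bar>real ((rounded_walk G ^^ T) (random_start Q \<zeta>) v) - real ((rounded_walk G ^^ T) (random_start Q \<zeta>) u)\<bar> \<le> real T + 2"
      using rz[OF v] rz[OF u] by (simp add: abs_le_iff)
    then show ?thesis by linarith
  qed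
  show ?thesis unfolding accepts_def using 1 2 degree_pos[OF v] by blast
qed

text \<open>The least identifier in a closed I survives flooding, so I has charge at least n Q - |I|
  Q \<ge> Q up to floors, and this charge is conserved. Acceptance permits 2T + 2 per unit of
  volume: T + 2 by the test and T for undone rounding. One further n^2 pays for the floors, whence
  2T + 3.\<close>

lemma connected_if_accepts:
  fixes Q T :: nat
  assumes acc: "\<And>v. v \<in> verts G \<Longrightarrow> accepts G i T Q \<zeta> v"
    and Q: "(card (verts G))\<^sup>2 * (2 * T + 3) < Q"
    and I: "I \<noteq> {}" "I \<subset> verts G"
  shows "\<exists>v\<in>I. \<exists>u\<in>neighbors G v. u \<notin> I"
proof (rule ccontr)
  assume "\<not> ?thesis"
  then have closed: "\<And>v u. v \<in> I \<Longrightarrow> u \<in> neighbors G v \<Longrightarrow> u \<in> I" by auto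
  define n where "n = card (verts G)"
  have fI: "finite I" using I finite_verts by (meson finite_subset psubset_imp_subset)
  have cI: "card I < n" unfolding n_def using I finite_verts by (intro psubset_card_mono) auto
  obtain w where w: "w \<in> I" "\<And>u. u \<in> I \<Longrightarrow> i w \<le> i u"
    using ex_min_if_finite[of "i ` I"] fI I(1) by (force simp: not_less)
  have wV: "w \<in> verts G" using w I by auto
  have leader: "(flood_step G ^^ T) i w = i w"
    using flood_le[of T i w] flood_ge_closed[OF closed w(2) w(1)] by (simp add: antisym)
  let ?x = "leader_start G i T Q"
  have on_I: "deg_inner G f (\<lambda>v. of_bool (v \<in> I)) = (\<Sum>v\<in>I. degree G v * f v)" for f :: "'a \<Rightarrow> real"
  proof -
    have "(\<Sum>v\<in>verts G. degree G v * f v * of_bool (v \<in> I)) = (\<Sum>v\<in>verts G. if v \<in> I then degree G v * f v else 0)"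
      by (intro sum.cong) auto
    then show ?thesis using I finite_verts
      by (simp add: deg_inner_def sum.inter_restrict[symmetric] Int_absorb1 psubset_imp_subset)
  qed
  have "(\<Sum>v\<in>I. degree G v * real Q) - card I * real Q + (n * real Q - n) \<le>
      (\<Sum>v\<in>I. degree G v * real Q - Q) + of_bool True * (n * real Q - real (degree G w))"
    using degree_less_card[OF wV] by (simp add: sum_subtractf n_def)
  also have "\<dots> \<le> (\<Sum>v\<in>I. degree G v * real Q - Q) + (\<Sum>v\<in>I. of_bool ((flood_step G ^^ T) i v = i v) * (n * real Q - real (degree G v)))"
  proof (rule add_left_mono)
    have "degree G v \<le> n * Q" if "v \<in> I" for v
    proof -
      have "degree G v \<le> n * 1" using degree_less_card[of v] that I by (auto simp: n_def)
      also have "\<dots> \<le> n * Q" using Q by (intro mult_le_mono2) simp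
      finally show ?thesis .
    qed
    then have "0 \<le> n * real Q - real (degree G v)" if "v \<in> I" for v
      using that by (metis diff_ge_0_iff_ge of_nat_le_iff of_nat_mult)
    then show "of_bool True * (n * real Q - real (degree G w)) \<le> (\<Sum>v\<in>I. of_bool ((flood_step G ^^ T) i v = i v) * (n * real Q - real (degree G v)))"
      using member_le_sum[of w I "\<lambda>v. of_bool ((flood_step G ^^ T) i v = i v) * (n * real Q - real (degree G v))"] w(1) fI leader
      by simp
  qed
  also have "\<dots> \<le> (\<Sum>v\<in>I. degree G v * real (?x v))"
    unfolding sum.distrib[symmetric] n_def
  proof (rule sum_mono)
    fix v assume "v \<in> I"
    then have "v \<in> verts G" using I by auto
    from leader_start_mass(1)[OF this, where Q = Q and T = T and i = i]
    show "degree G v * real Q - Q + of_bool ((flood_step G ^^ T) i v = i v) * (card (verts G) * real Q - real (degree G v))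
      \<le> degree G v * real (?x v)" by simp
  qed
  also have "\<dots> = (\<Sum>v\<in>I. degree G v * (lazy_walk G ^^ T) (\<lambda>v. real (?x v)) v)"
    using lazy_walk_pow_closed_set[where t = T and f = "\<lambda>v. real (?x v)", OF closed, symmetric]
    unfolding on_I .
  also have "\<dots> \<le> (\<Sum>v\<in>I. degree G v * (real Q + real (2 * T + 2)))"
  proof (intro sum_mono mult_left_mono)
    fix v assume "v \<in> I"
    then have v: "v \<in> verts G" using I by auto
    have "real ((rounded_walk G ^^ T) ?x v) \<le> Q + T + 2"
      using acc[OF v] unfolding accepts_def by linarith
    then show "(lazy_walk G ^^ T) (\<lambda>v. real (?x v)) v \<le> real Q + real (2 * T + 2)"
      using rounded_walk_pow_bounds(2)[OF v, of T ?x] by simp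
  qed simp
  also have "\<dots> = (\<Sum>v\<in>I. degree G v * real Q) + real (vol G I) * real (2 * T + 2)"
    by (simp add: vol_def sum.distrib distrib_left sum_distrib_right)
  also have "real (vol G I) * real (2 * T + 2) \<le> real (n\<^sup>2) * real (2 * T + 2)"
    using vol_mono[of I "verts G"] I vol_le unfolding n_def
    by (intro mult_right_mono) (simp_all only: of_nat_le_iff of_nat_0_le_iff, auto)
  finally have "n * real Q - n - card I * real Q \<le> real (n\<^sup>2) * real (2 * T + 2)" by simp
  moreover have "(real (card I) + 1) * real Q \<le> n * real Q"
    using cI by (intro mult_right_mono) auto
  then have "card I * real Q + real Q \<le> n * real Q" by (simp only: distrib_right mult_1)
  moreover have "real n \<le> real (n\<^sup>2)" unfolding of_nat_le_iff using cI by (simp add: power2_eq_square)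
  ultimately have "real Q \<le> real (n\<^sup>2) * real (2 * T + 2) + real (n\<^sup>2)" by argo
  also have "\<dots> = real (n\<^sup>2 * (2 * T + 3))" by (simp add: algebra_simps)
  finally show False using Q unfolding of_nat_le_iff n_def by simp
qed

text \<open>The quantifier order matters: \<gamma> and v depend on the graph and the cut, but not on
  the seeds. The first bound on r collects the spread n (T + 2), the rounding loss T and the volume
  n^2; the second leaves the factor 2 that separates the seed values.\<close>

lemma sparse_cut_rejection:
  fixes Q T :: nat and r \<delta> :: real
  assumes S: "S \<noteq> {}" "S \<subseteq> verts G" "2 * vol G S \<le> vol G (verts G)"
    and cut: "card (edges_between G S (verts G - S)) \<le> \<delta> * vol G S" and \<delta>: "\<delta> \<le> 1"
    and Q: "(card (verts G))\<^sup>2 * (2 * T + 3) < Q"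
    and r: "(card (verts G))\<^sup>2 * (card (verts G) * (T + 2) + T) < r * Q"
      "4 * card (verts G) * r \<le> (1 - \<delta>) ^ T"
  obtains \<gamma> :: "'a \<Rightarrow> real" and v where "v \<in> verts G" "2 * r \<le> \<bar>\<gamma> v\<bar>"
    "\<And>\<zeta>. (\<And>v. v \<in> verts G \<Longrightarrow> accepts G i T Q \<zeta> v) \<Longrightarrow> \<bar>\<Sum>v\<in>verts G. \<gamma> v * real (\<zeta> v)\<bar> < r"
proof -
  define n where "n = card (verts G)"
  obtain \<gamma> :: "'a \<Rightarrow> real" and w where w: "w \<in> verts G" "(1 - \<delta>) ^ T / (2 * card (verts G)) \<le> \<bar>\<gamma> w\<bar>"
    and \<gamma>: "\<And>f (c :: real) (\<rho> :: real). (\<And>v. v \<in> verts G \<Longrightarrow> \<bar>(lazy_walk G ^^ T) f v - c\<bar> \<le> \<rho>) \<Longrightarrow>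
      \<bar>\<Sum>v\<in>verts G. \<gamma> v * f v\<bar> \<le> vol G (verts G) * \<rho>"
    by (rule sparse_cut_functional[OF S cut \<delta>, of T], rule that, assumption+, blast)
  have n: "n > 0" using w finite_verts by (auto simp: n_def card_gt_0_iff)
  have "2 * r \<le> (1 - \<delta>) ^ T / (2 * n)" using r(2) n by (simp add: n_def field_simps)
  also have "\<dots> \<le> \<bar>\<gamma> w\<bar>" using w by (simp add: n_def)
  finally have "2 * r \<le> \<bar>\<gamma> w\<bar>" .
  moreover have "\<bar>\<Sum>v\<in>verts G. \<gamma> v * real (\<zeta> v)\<bar> < r" if acc: "\<And>v. v \<in> verts G \<Longrightarrow> accepts G i T Q \<zeta> v" for \<zeta>
  proof -
    let ?z = "random_start Q \<zeta>"
    let ?f = "\<lambda>v. real ((rounded_walk G ^^ T) ?z v)"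
    have near: "\<bar>?f v - ?f w\<bar> \<le> n * (real T + 2)" if "v \<in> verts G" for v
      unfolding n_def
    proof (rule spread_bound[where f = ?f and \<tau> = "real T + 2", OF _ _ that w(1)])
      fix S assume "S \<noteq> {}" "S \<subset> verts G"
      with acc Q show "\<exists>v\<in>S. \<exists>u\<in>neighbors G v. u \<notin> S" by (rule connected_if_accepts)
    next
      fix v u assume "v \<in> verts G" "u \<in> neighbors G v"
      then show "\<bar>?f u - ?f v\<bar> \<le> real T + 2"
        using acc[of v] unfolding accepts_def by (fastforce simp: abs_le_iff)
    qed
    have "\<bar>(lazy_walk G ^^ T) (\<lambda>v. real (?z v)) v - ?f w\<bar> \<le> n * (real T + 2) + T" if "v \<in> verts G" for v
      using near[OF that] rounded_walk_pow_bounds[OF that, of T ?z] by (simp add: abs_le_iff)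
    from \<gamma>[OF this] have "\<bar>\<Sum>v\<in>verts G. \<gamma> v * real (?z v)\<bar> \<le> vol G (verts G) * (n * (real T + 2) + T)" .
    also have "\<dots> \<le> real (n\<^sup>2) * (n * (real T + 2) + T)"
      using vol_le unfolding n_def by (intro mult_right_mono) (simp_all only: of_nat_le_iff, auto)
    also have "\<dots> < r * Q" using r(1) by (simp add: n_def algebra_simps)
    also have "(\<Sum>v\<in>verts G. \<gamma> v * real (?z v)) = (\<Sum>v\<in>verts G. \<gamma> v * real (\<zeta> v)) * Q"
      by (simp add: random_start_def sum_distrib_right mult.assoc)
    finally have "\<bar>(\<Sum>v\<in>verts G. \<gamma> v * real (\<zeta> v)) * Q\<bar> < r * Q" .
    then show ?thesis using Q by (simp add: abs_mult)
  qed
  ultimately show ?thesis using that w(1) by blast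
qed

end

section \<open>The distributed algorithm\<close>

text \<open>The width is fixed so that a pair can be split after B bits.\<close>

definition nat_to_bits :: "nat \<Rightarrow> nat \<Rightarrow> bool list" where
  "nat_to_bits B m = map (bit m) [0..<B]"

definition bits_to_nat :: "bool list \<Rightarrow> nat" where
  "bits_to_nat xs = horner_sum of_bool 2 xs"

lemma bits_to_nat_to_bits: "m < 2 ^ B \<Longrightarrow> bits_to_nat (nat_to_bits B m) = m"
  by (simp add: nat_to_bits_def bits_to_nat_def horner_sum_bit_eq_take_bit take_bit_nat_eq_self)

text \<open>A state consists of the number of vertices, the identifier, the number of completed rounds, two
  registers and the verdict. The second register receives the random value in the very first round.\<close>
type_synonym state = "nat \<times> nat \<times> nat \<times> nat \<times> nat \<times> bool"

definition encode_msg :: "nat \<Rightarrow> nat \<times> nat \<Rightarrow> message" where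
  "encode_msg B m = nat_to_bits B (fst m) @ nat_to_bits B (snd m)"

definition decode_msg :: "nat \<Rightarrow> message \<Rightarrow> nat \<times> nat" where
  "decode_msg B xs = (bits_to_nat (take B xs), bits_to_nat (drop B xs))"

lemma decode_encode_msg: "fst m < 2 ^ B \<Longrightarrow> snd m < 2 ^ B \<Longrightarrow> decode_msg B (encode_msg B m) = m"
  using bits_to_nat_to_bits[of "fst m" B] bits_to_nat_to_bits[of "snd m" B]
  by (simp add: decode_msg_def encode_msg_def nat_to_bits_def)

lemma length_encode_msg: "length (encode_msg B m) = 2 * B"
  by (simp add: encode_msg_def nat_to_bits_def)

text \<open>T rounds of flooding, one round of conversion that uses only the number of messages, T
  rounds of the walk and one round of comparison: 2T + 2 in all. A vertex learns its degree from the
  length of its inbox.\<close>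

definition update :: "(nat \<Rightarrow> nat) \<Rightarrow> (nat \<Rightarrow> nat) \<Rightarrow> state \<Rightarrow> (nat \<times> nat) list \<Rightarrow> state" where
  "update T Q s ms = (case s of (n, i, k, a, b, r) \<Rightarrow>
     let d = length ms in
     if k < T n then (n, i, Suc k, Min (set (a # map fst ms)), b, r)
     else if k = T n then (n, i, Suc k, Q n + (if a = i then n * Q n div d else 0) - Q n div d, b * Q n, r)
     else if k \<le> 2 * T n then
       (n, i, Suc k, (d * a + sum_list (map fst ms)) div (2 * d), (d * b + sum_list (map snd ms)) div (2 * d), r)
     else
       (n, i, Suc k, a, b, d > 0 \<and> \<bar>int a - int (Q n)\<bar> \<le> int (T n) + 2 \<and>
          (\<forall>m\<in>set ms. \<bar>int b - int (snd m)\<bar> \<le> int (T n) + 2)))"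

definition tester :: "(nat \<Rightarrow> nat) \<Rightarrow> (nat \<Rightarrow> nat) \<Rightarrow> (nat \<Rightarrow> nat) \<Rightarrow> nat algorithm" where
  "tester T Q B = \<lparr>
     init = (\<lambda>n i. to_nat ((n, i, 0, i, 0, False) :: state)),
     compute = (\<lambda>s. case from_nat s :: state of (n, i, k, a, b, r) \<Rightarrow>
       if k = 0 then map_pmf (\<lambda>z. to_nat ((n, i, k, a, z, r) :: state)) (pmf_of_set {..<3}) else return_pmf s),
     send = (\<lambda>s p. case from_nat s :: state of (n, i, k, a, b, r) \<Rightarrow> encode_msg (B n) (a, b)),
     receive = (\<lambda>s xs. case from_nat s :: state of (n, i, k, a, b, r) \<Rightarrow>
       to_nat (update T Q (n, i, k, a, b, r) (map (decode_msg (B n)) xs))),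
     out = (\<lambda>s. case from_nat s :: state of (n, i, k, a, b, r) \<Rightarrow>
       if k \<le> 2 * T n + 1 then None else Some r)\<rparr>"

text \<open>The four bounds make every register content fit into B bits: identifiers, leader values
  up to (n + 1) Q, scaled random values up to 2Q, and seeds up to 2.\<close>

locale tester_execution =
  fixes N :: "'a network" and c :: nat and T Q B :: "nat \<Rightarrow> nat"
  assumes valid: "valid_network c N"
    and B_ident: "card (verts (graph N)) ^ c < 2 ^ B (card (verts (graph N)))"
    and B_leader: "Suc (card (verts (graph N))) * Q (card (verts (graph N))) < 2 ^ B (card (verts (graph N)))"
    and B_random: "2 * Q (card (verts (graph N))) < 2 ^ B (card (verts (graph N)))"
    and B_seed: "2 < (2 :: nat) ^ B (card (verts (graph N)))"
begin

abbreviation "G \<equiv> graph N"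
abbreviation "V \<equiv> verts (graph N)"
abbreviation "n \<equiv> card (verts (graph N))"
abbreviation "Alg \<equiv> tester T Q B"

sublocale finite_graph G
  by unfold_locales (use valid in \<open>simp add: valid_network_def\<close>)

lemma port_bij: "v \<in> V \<Longrightarrow> bij_betw (port N v) {1..<Suc (degree G v)} (neighbors G v)"
  using valid by (simp add: valid_network_def atLeastLessThanSuc_atLeastAtMost)

lemma ident_le: "v \<in> V \<Longrightarrow> ident N v \<le> n ^ c"
  using valid by (auto simp: valid_network_def)

text \<open>The walk has exponent 0 at k = T + 1, just after the conversion. The \<open>min\<close>
  freezes it after T steps, since the last round leaves both registers unchanged.\<close>

definition values_at :: "('a \<Rightarrow> nat) \<Rightarrow> nat \<Rightarrow> 'a \<Rightarrow> nat \<times> nat" where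
  "values_at \<zeta> k v = (if k \<le> T n then ((flood_step G ^^ k) (ident N) v, \<zeta> v)
     else let l = min (k - Suc (T n)) (T n) in
       ((rounded_walk G ^^ l) (leader_start G (ident N) (T n) (Q n)) v,
        (rounded_walk G ^^ l) (random_start (Q n) \<zeta>) v))"

definition state_at :: "('a \<Rightarrow> nat) \<Rightarrow> nat \<Rightarrow> 'a \<Rightarrow> state" where
  "state_at \<zeta> k v = (n, ident N v, k, fst (values_at \<zeta> k v), snd (values_at \<zeta> k v),
     k = 2 * T n + 2 \<and> accepts G (ident N) (T n) (Q n) \<zeta> v)"

lemma values_at_less:
  assumes "\<And>v. v \<in> V \<Longrightarrow> \<zeta> v \<le> 2" "v \<in> V"
  shows "fst (values_at \<zeta> k v) < 2 ^ B n" "snd (values_at \<zeta> k v) < 2 ^ B n"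
proof -
  have "(rounded_walk G ^^ l) (leader_start G (ident N) (T n) (Q n)) v \<le> Suc n * Q n" for l
    by (rule rounded_walk_pow_le[OF _ assms(2)]) (use leader_start_le in simp)
  moreover have "(rounded_walk G ^^ l) (random_start (Q n) \<zeta>) v \<le> 2 * Q n" for l
    by (rule rounded_walk_pow_le[OF _ assms(2)]) (use assms in \<open>simp add: random_start_def\<close>)
  moreover have "(flood_step G ^^ k) (ident N) v \<le> n ^ c"
    using flood_le ident_le[OF assms(2)] by (rule order_trans)
  moreover have "\<zeta> v \<le> 2" using assms by simp
  ultimately show "fst (values_at \<zeta> k v) < 2 ^ B n" "snd (values_at \<zeta> k v) < 2 ^ B n"
    using B_ident B_leader B_random B_seed unfolding values_at_def Let_def
    by (auto intro: order.strict_trans1)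
qed

lemma sum_list_ports:
  assumes "v \<in> V"
  shows "sum_list (map (\<lambda>p. f (port N v p)) [1..<Suc (degree G v)]) = (\<Sum>u\<in>neighbors G v. f u :: nat)"
  using sum.reindex_bij_betw[OF port_bij[OF assms], of f]
  by (simp only: sum_list_distinct_conv_sum_set distinct_upt set_upt)

lemma set_ports:
  assumes "v \<in> V"
  shows "(\<lambda>p. f (port N v p)) ` {1..<Suc (degree G v)} = f ` neighbors G v"
  using bij_betw_imp_surj_on[OF port_bij[OF assms]] by (metis image_image)

lemma update_state_at:
  assumes v: "v \<in> V" and k: "k \<le> 2 * T n + 1"
  shows "update T Q (state_at \<zeta> k v) (map (\<lambda>p. values_at \<zeta> k (port N v p)) [1..<Suc (degree G v)]) =
    state_at \<zeta> (Suc k) v"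
proof -
  define ms where "ms = map (\<lambda>p. values_at \<zeta> k (port N v p)) [1..<Suc (degree G v)]"
  have len: "length ms = degree G v" by (simp add: ms_def)
  have set_ms: "set ms = values_at \<zeta> k ` neighbors G v"
    unfolding ms_def set_map set_upt by (rule set_ports[OF v])
  have sum_ms: "sum_list (map fst ms) = (\<Sum>u\<in>neighbors G v. fst (values_at \<zeta> k u))"
    "sum_list (map snd ms) = (\<Sum>u\<in>neighbors G v. snd (values_at \<zeta> k u))"
    unfolding ms_def map_map comp_def
    using sum_list_ports[OF v, of "\<lambda>u. fst (values_at \<zeta> k u)"] sum_list_ports[OF v, of "\<lambda>u. snd (values_at \<zeta> k u)"]
    by (simp_all del: upt_Suc)
  consider "k < T n" | "k = T n" | "T n < k" "k \<le> 2 * T n" | "k = 2 * T n + 1" using k by linarith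
  then have "update T Q (state_at \<zeta> k v) ms = state_at \<zeta> (Suc k) v"
  proof cases
    case 1
    then have "update T Q (state_at \<zeta> k v) ms =
        (n, ident N v, Suc k, Min (insert (fst (values_at \<zeta> k v)) (fst ` set ms)), \<zeta> v, False)"
      by (simp add: update_def state_at_def values_at_def)
    also have "\<dots> = state_at \<zeta> (Suc k) v"
      unfolding set_ms using 1 by (simp add: state_at_def values_at_def flood_step_def image_image)
    finally show ?thesis .
  next
    case 2
    then show ?thesis
      unfolding update_def state_at_def len Let_def
      by (simp add: values_at_def leader_start_def random_start_def)
  next
    case 3
    then have l: "k - T n = Suc (k - Suc (T n))" "k - Suc (T n) < T n" by auto
    show ?thesis
      unfolding update_def state_at_def len Let_def case_prod_conv sum_ms
      using 3 l by (simp add: values_at_def rounded_walk_def min_def Let_def)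
  next
    case 4
    then show ?thesis
      unfolding update_def state_at_def len Let_def case_prod_conv set_ms
      by (simp add: values_at_def accepts_def Let_def)
  qed
  then show ?thesis by (simp only: ms_def)
qed

definition final :: nat where "final = 2 * T n + 2"

definition config :: "('a \<Rightarrow> nat) \<Rightarrow> nat \<Rightarrow> 'a \<Rightarrow> nat" where
  "config \<zeta> k v = to_nat (state_at \<zeta> (min k final) v)"

lemma out_config: "out Alg (config \<zeta> k v) =
  (if k < final then None else Some (accepts G (ident N) (T n) (Q n) \<zeta> v))"
  by (auto simp: tester_def config_def state_at_def final_def)

text \<open>Before termination s enters only through \<open>out\<close>, since the initial
  configuration is not of the form \<open>config\<close>: its seeds are not drawn yet.\<close>

lemma communicate_config:
  assumes \<zeta>: "\<And>v. v \<in> V \<Longrightarrow> \<zeta> v \<le> 2"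
    and s: "\<And>v. v \<in> V \<Longrightarrow> out Alg (s v) = (if k < final then None else Some (accepts G (ident N) (T n) (Q n) \<zeta> v))"
    and s_final: "\<And>v. v \<in> V \<Longrightarrow> k \<ge> final \<Longrightarrow> s v = config \<zeta> k v"
    and s': "\<And>v. v \<in> V \<Longrightarrow> s' v = config \<zeta> k v" and v: "v \<in> V"
  shows "communicate Alg N s s' v = config \<zeta> (Suc k) v"
proof (cases "k < final")
  case True
  then have min: "min k final = k" "min (Suc k) final = Suc k" by auto
  have port: "port N v p \<in> V" if "p \<in> {1..<Suc (degree G v)}" for p
    using that bij_betwE[OF port_bij[OF v]] neighbors_in_verts by blast
  have msg: "sent Alg s s' u q = encode_msg (B n) (values_at \<zeta> k u)" if "u \<in> V" for u q
    using s[OF that] s'[OF that] True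
    by (simp add: sent_def tester_def config_def state_at_def min)
  have inbox: "map (decode_msg (B n)) (inbox Alg N s s' v) =
      map (\<lambda>p. values_at \<zeta> k (port N v p)) [1..<Suc (degree G v)]"
    unfolding inbox_def map_map Let_def comp_def
  proof (rule map_cong[OF refl])
    fix p assume "p \<in> set [1..<Suc (degree G v)]"
    then have "p \<in> {1..<Suc (degree G v)}" by (simp only: set_upt)
    then have "port N v p \<in> V" by (rule port)
    then show "decode_msg (B n) (sent Alg s s' (port N v p) (port_to N (port N v p) v)) = values_at \<zeta> k (port N v p)"
      using values_at_less[of \<zeta> "port N v p" k, OF \<zeta>]
      by (simp add: msg decode_encode_msg)
  qed
  have "communicate Alg N s s' v = receive Alg (config \<zeta> k v) (inbox Alg N s s' v)"
    using s[OF v] s'[OF v] True by (simp add: communicate_def)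
  also have "\<dots> = to_nat (update T Q (state_at \<zeta> k v) (map (decode_msg (B n)) (inbox Alg N s s' v)))"
    by (simp add: tester_def config_def min state_at_def)
  also have "\<dots> = config \<zeta> (Suc k) v"
    unfolding inbox using update_state_at[OF v, of k \<zeta>] True by (simp add: config_def min final_def)
  finally show ?thesis .
next
  case False
  then show ?thesis using s[OF v] s_final[OF v] by (simp add: communicate_def config_def)
qed

section \<open>Reduction of a run to its first random draw\<close>

definition start :: "'a \<Rightarrow> nat" where "start v = init Alg n (ident N v)"

definition seed :: "('a \<Rightarrow> nat) \<Rightarrow> 'a \<Rightarrow> nat" where
  "seed s v = (case from_nat (s v) :: state of (_, _, _, _, b, _) \<Rightarrow> b)"

definition first_draw :: "('a \<Rightarrow> nat) pmf" where "first_draw = local_computation Alg N start"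

lemma first_draw_eq:
  "first_draw = Pi_pmf V undefined (\<lambda>v. map_pmf (\<lambda>z. to_nat ((n, ident N v, 0, ident N v, z, False) :: state)) (pmf_of_set {..<3}))"
  by (simp add: first_draw_def local_computation_def tester_def start_def)

lemma first_draw_config:
  assumes "s' \<in> set_pmf first_draw" "v \<in> V"
  shows "s' v = config (seed s') 0 v" "seed s' v \<le> 2"
proof -
  have "s' v \<in> set_pmf (map_pmf (\<lambda>z. to_nat ((n, ident N v, 0, ident N v, z, False) :: state)) (pmf_of_set {..<3}))"
    using assms unfolding first_draw_eq by (auto simp: set_Pi_pmf[OF finite_verts] PiE_dflt_def)
  then obtain z where "z < 3" "s' v = to_nat ((n, ident N v, 0, ident N v, z, False) :: state)"
    by (auto simp: set_pmf_of_set lessThan_empty_iff)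
  then show "s' v = config (seed s') 0 v" "seed s' v \<le> 2"
    by (simp_all add: config_def state_at_def values_at_def seed_def)
qed

lemma local_computation_config:
  assumes "\<And>v. v \<in> V \<Longrightarrow> s v = config \<zeta> (Suc k) v"
  shows "local_computation Alg N s = return_pmf (\<lambda>v. if v \<in> V then s v else undefined)"
proof -
  have "(if out Alg (s v) = None then compute Alg (s v) else return_pmf (s v)) = return_pmf (s v)" if "v \<in> V" for v
    using assms[OF that] by (simp add: tester_def config_def state_at_def final_def)
  then have "local_computation Alg N s = Pi_pmf V undefined (\<lambda>v. return_pmf (s v))"
    unfolding local_computation_def by (intro Pi_pmf_cong) auto
  then show ?thesis by (simp add: Pi_pmf_return_pmf finite_verts)
qed

text \<open>After the first draw the run is deterministic. The value \<open>undefined\<close>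
  outside V is the default of \<open>Pi_pmf\<close>, kept so that \<open>run_eq\<close> is an
  equality of distributions.\<close>

primrec trace :: "nat \<Rightarrow> ('a \<Rightarrow> nat) \<Rightarrow> 'a \<Rightarrow> nat" where
  "trace 0 s' = communicate Alg N start s'"
| "trace (Suc t) s' = communicate Alg N (trace t s') (\<lambda>v. if v \<in> V then trace t s' v else undefined)"

lemma trace_config:
  assumes "s' \<in> set_pmf first_draw" "v \<in> V"
  shows "trace t s' v = config (seed s') (Suc t) v"
  using assms(2)
proof (induction t arbitrary: v)
  case 0
  have "out Alg (start v) = None" for v by (simp add: tester_def start_def)
  then show ?case
    unfolding trace.simps using first_draw_config[OF assms(1)] 0
    by (intro communicate_config) (auto simp: final_def)
next
  case (Suc t)
  then show ?case
    unfolding trace.simps using first_draw_config[OF assms(1)]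
    by (intro communicate_config) (simp_all add: out_config)
qed

lemma run_eq: "run Alg N (Suc t) = map_pmf (trace t) first_draw"
proof (induction t)
  case 0
  have "(\<lambda>v. init Alg n (ident N v)) = start" by (simp add: start_def fun_eq_iff)
  then show ?case
    by (simp add: bind_return_pmf one_round_def first_draw_def[symmetric])
next
  case (Suc t)
  have "run Alg N (Suc (Suc t)) = bind_pmf first_draw (\<lambda>s'. one_round Alg N (trace t s'))"
    unfolding run.simps(2)[of _ _ "Suc t"] Suc by (simp add: bind_map_pmf)
  also have "\<dots> = bind_pmf first_draw (\<lambda>s'. return_pmf (trace (Suc t) s'))"
    by (intro bind_pmf_cong refl) (simp add: one_round_def local_computation_config[OF trace_config])
  finally show ?case by (simp add: map_pmf_def)
qed

lemma congest_tester:
  assumes "0 \<le> K * log 2 (real n)" "real (2 * B n) \<le> K * log 2 (real n)"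
  shows "congest K Alg N"
  unfolding congest_def
proof (intro allI ballI)
  fix t s s' v p
  assume s: "s \<in> set_pmf (run Alg N t)" and s': "s' \<in> set_pmf (local_computation Alg N s)" and v: "v \<in> V"
  have "\<exists>\<zeta> k. s' v = config \<zeta> k v"
  proof (cases t)
    case 0
    then have "s = start" using s by (simp add: start_def fun_eq_iff)
    then show ?thesis using s' first_draw_config(1)[OF _ v] by (auto simp: first_draw_def)
  next
    case (Suc t')
    then obtain s0 where s0: "s0 \<in> set_pmf first_draw" "s = trace t' s0"
      using s by (auto simp: run_eq simp del: run.simps)
    then show ?thesis
      using s' v trace_config[OF s0(1)] by (auto simp: local_computation_config[OF trace_config])
  qed
  then have "length (send Alg (s' v) p) = 2 * B n"
    by (auto simp: tester_def config_def state_at_def length_encode_msg)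
  then show "real (length (sent Alg s s' v p)) \<le> K * log 2 (real n)"
    using assms by (simp add: sent_def)
qed

lemma terminates_tester: "terminates_within Alg N (2 * T n + 2)"
  unfolding terminates_within_def
  using run_eq[of "2 * T n + 1"] by (auto simp: trace_config out_config final_def simp del: run.simps trace.simps)

lemma prob_final:
  "measure_pmf.prob (run Alg N (2 * T n + 2)) X = measure_pmf.prob first_draw {s'. trace (2 * T n + 1) s' \<in> X}"
  using run_eq[of "2 * T n + 1"] by (simp add: vimage_def del: run.simps trace.simps)

lemma out_final:
  assumes "s' \<in> set_pmf first_draw" "v \<in> V"
  shows "out Alg (trace (2 * T n + 1) s' v) = Some (accepts G (ident N) (T n) (Q n) (seed s') v)"
  using trace_config[OF assms, of "2 * T n + 1"] by (simp add: out_config final_def del: trace.simps)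

lemma all_accept_tester:
  assumes "\<And>\<zeta> v. (\<And>v. v \<in> V \<Longrightarrow> \<zeta> v \<le> 2) \<Longrightarrow> v \<in> V \<Longrightarrow> accepts G (ident N) (T n) (Q n) \<zeta> v"
  shows "measure_pmf.prob (run Alg N (2 * T n + 2)) (all_accept Alg N) = 1"
  unfolding prob_final
proof (subst measure_pmf.prob_eq_1, simp, rule AE_pmfI)
  fix s' assume s': "s' \<in> set_pmf first_draw"
  then show "s' \<in> {s'. trace (2 * T n + 1) s' \<in> all_accept Alg N}"
    using out_final[OF s'] assms[OF first_draw_config(2)[OF s']] by (auto simp: all_accept_def simp del: trace.simps)
qed

lemma some_reject_tester:
  assumes le: "measure_pmf.prob first_draw {s'. \<forall>v\<in>V. accepts G (ident N) (T n) (Q n) (seed s') v} \<le> 1 / 3"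
  shows "measure_pmf.prob (run Alg N (2 * T n + 2)) (some_reject Alg N) \<ge> 2 / 3"
proof -
  let ?E = "{s'. \<forall>v\<in>V. accepts G (ident N) (T n) (Q n) (seed s') v}"
  have "2 / 3 \<le> measure_pmf.prob first_draw (- ?E)"
    using le measure_pmf.prob_compl[of ?E first_draw] by (simp add: Compl_eq_Diff_UNIV)
  also have "\<dots> \<le> measure_pmf.prob first_draw {s'. trace (2 * T n + 1) s' \<in> some_reject Alg N}"
  proof (rule measure_pmf.finite_measure_mono_AE, rule AE_pmfI, rule impI)
    fix s' assume s': "s' \<in> set_pmf first_draw" and "s' \<in> - ?E"
    then obtain v where "v \<in> V" "\<not> accepts G (ident N) (T n) (Q n) (seed s') v" by auto
    then have "out Alg (trace (2 * T n + 1) s' v) = Some False" by (simp only: out_final[OF s'])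
    then show "s' \<in> {s'. trace (2 * T n + 1) s' \<in> some_reject Alg N}"
      using \<open>v \<in> V\<close> unfolding some_reject_def by blast
  qed simp
  finally show ?thesis unfolding prob_final .
qed

text \<open>Unanimous acceptance makes the functional small. With all other seeds fixed it is affine
  in the seed at v, so this happens with probability at most 1/3.\<close>

lemma some_reject_of_functional:
  fixes \<gamma> :: "'a \<Rightarrow> real"
  assumes v: "v \<in> V" and big: "2 * r \<le> \<bar>\<gamma> v\<bar>"
    and small: "\<And>\<zeta>. (\<And>v. v \<in> V \<Longrightarrow> accepts G (ident N) (T n) (Q n) \<zeta> v) \<Longrightarrow> \<bar>\<Sum>v\<in>V. \<gamma> v * real (\<zeta> v)\<bar> < r"
  shows "measure_pmf.prob (run Alg N (2 * T n + 2)) (some_reject Alg N) \<ge> 2 / 3"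
proof (rule some_reject_tester)
  let ?E = "{s'. \<bar>\<Sum>v\<in>V. \<gamma> v * real (seed s' v)\<bar> < r}"
  have "measure_pmf.prob first_draw {s'. \<forall>v\<in>V. accepts G (ident N) (T n) (Q n) (seed s') v} \<le>
      measure_pmf.prob first_draw ?E"
    using small by (intro measure_pmf.finite_measure_mono) auto
  also have "\<dots> \<le> 1 / 3"
    unfolding first_draw_eq
  proof (rule prob_Pi_pmf_le[OF finite_verts v])
    fix f
    have "(\<Sum>u\<in>V. \<gamma> u * real (seed (f(v := to_nat ((n, ident N v, 0, ident N v, z, False) :: state))) u)) =
       \<gamma> v * real z + (\<Sum>u\<in>V - {v}. \<gamma> u * real (seed f u))" for z
    proof -
      have "(\<Sum>u\<in>V - {v}. \<gamma> u * real (seed (f(v := to_nat ((n, ident N v, 0, ident N v, z, False) :: state))) u)) =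
        (\<Sum>u\<in>V - {v}. \<gamma> u * real (seed f u))"
        by (intro sum.cong) (auto simp: seed_def)
      then show ?thesis using v finite_verts by (simp add: sum.remove seed_def)
    qed
    then show "measure_pmf.prob (map_pmf (\<lambda>z. to_nat ((n, ident N v, 0, ident N v, z, False) :: state)) (pmf_of_set {..<3}))
       {y. f(v := y) \<in> ?E} \<le> 1 / 3"
      using prob_small_affine_le[OF big, of "\<Sum>u\<in>V - {v}. \<gamma> u * real (seed f u)"]
      by (simp add: vimage_def)
  qed
  finally show "measure_pmf.prob first_draw {s'. \<forall>v\<in>V. accepts G (ident N) (T n) (Q n) (seed s') v} \<le> 1 / 3" .
qed

end

section \<open>Choice of parameters\<close>

definition threshold :: "real \<Rightarrow> nat \<Rightarrow> real" where
  "threshold \<Phi> n = max \<Phi> (1 / real n ^ 2)"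

text \<open>360 lies between two constraints: 360/4 = 90 covers the exponent 86 required for mixing,
  and 360/500 < 1 keeps the signal of a sparse cut above 1/n.\<close>

definition walk_length :: "real \<Rightarrow> nat \<Rightarrow> nat" where
  "walk_length \<phi> n = nat \<lceil>360 * ln (real n) / \<phi>\<^sup>2\<rceil>"

text \<open>Identifiers reach n^c and the walk values stay below n^42; c + 44 exceeds both
  exponents.\<close>

definition msg_bits :: "nat \<Rightarrow> nat \<Rightarrow> nat" where
  "msg_bits c n = (c + 44) * nat \<lceil>log 2 (real n)\<rceil>"

lemma ln_ge_two_thirds: "2 \<le> n \<Longrightarrow> 2 / 3 \<le> ln (real n)"
  using ln2_ge_two_thirds by (rule order_trans) simp

lemma walk_length_bounds:
  assumes "2 \<le> n"
  shows "360 * ln (real n) / \<phi>\<^sup>2 \<le> walk_length \<phi> n" "walk_length \<phi> n \<le> 360 * ln (real n) / \<phi>\<^sup>2 + 1"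
proof -
  have "0 \<le> 360 * ln (real n) / \<phi>\<^sup>2" using assms by simp
  then show "360 * ln (real n) / \<phi>\<^sup>2 \<le> walk_length \<phi> n" "walk_length \<phi> n \<le> 360 * ln (real n) / \<phi>\<^sup>2 + 1"
    unfolding walk_length_def by linarith+
qed

lemma walk_length_mixing:
  assumes n: "2 \<le> n" and \<phi>: "0 < \<phi>" "\<phi> \<le> 1"
  shows "(1 - \<phi>\<^sup>2 / 4) ^ walk_length \<phi> n * ((real n)\<^sup>2 * (2 * real n * real (n ^ 40))\<^sup>2) \<le> 1"
proof -
  let ?T = "walk_length \<phi> n"
  have p: "0 < \<phi>\<^sup>2" "\<phi>\<^sup>2 \<le> 1" using \<phi> by (auto simp: power_le_one)
  have "360 * ln (real n) \<le> ?T * \<phi>\<^sup>2"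
    using walk_length_bounds(1)[OF n, of \<phi>] p by (simp add: divide_le_eq)
  then have e: "- (?T * (\<phi>\<^sup>2 / 4)) \<le> - (90 * ln (real n))" by simp
  have "(1 - \<phi>\<^sup>2 / 4) ^ ?T \<le> exp (- (\<phi>\<^sup>2 / 4)) ^ ?T"
    using p exp_ge_add_one_self[of "- (\<phi>\<^sup>2 / 4)"] by (intro power_mono) auto
  also have "\<dots> = exp (- (?T * (\<phi>\<^sup>2 / 4)))" by (simp flip: exp_of_nat_mult)
  also have "\<dots> \<le> exp (- (90 * ln (real n)))" using e by simp
  also have "\<dots> = 1 / real n ^ 90"
    using n by (simp add: exp_minus exp_of_nat_mult[of 90, simplified] inverse_eq_divide)
  finally have decay: "(1 - \<phi>\<^sup>2 / 4) ^ ?T \<le> 1 / real n ^ 90" .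
  have "(real n)\<^sup>2 * (2 * real n * real (n ^ 40))\<^sup>2 = 2\<^sup>2 * real n ^ 84"
    by (simp add: power_mult_distrib flip: power_mult power_add power_Suc2 power_Suc)
  also have "\<dots> \<le> real n ^ 2 * real n ^ 84"
    using n by (intro mult_right_mono power_mono) auto
  also have "\<dots> = real n ^ 86" by (simp flip: power_add)
  finally have "(1 - \<phi>\<^sup>2 / 4) ^ ?T * ((real n)\<^sup>2 * (2 * real n * real (n ^ 40))\<^sup>2) \<le> 1 / real n ^ 90 * real n ^ 86"
    by (intro mult_mono decay) auto
  also have "\<dots> \<le> 1" using n by (simp add: divide_le_eq power_increasing)
  finally show ?thesis .
qed

lemma walk_length_poly:
  assumes n: "2 \<le> n" and \<phi>: "1 / real n ^ 2 \<le> \<phi>"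
  shows "walk_length \<phi> n \<le> n ^ 15"
proof -
  have n1: "1 \<le> real n" using n by simp
  have pos: "0 < 1 / real n ^ 2" using n by simp
  then have "(1 / real n ^ 2)\<^sup>2 \<le> \<phi>\<^sup>2" using \<phi> by (intro power_mono) auto
  then have "360 * ln (real n) / \<phi>\<^sup>2 \<le> 360 * ln (real n) / (1 / real n ^ 2)\<^sup>2"
    using n pos by (intro divide_left_mono mult_pos_pos) (auto intro: less_le_trans)
  also have "\<dots> = 360 * ln (real n) * real n ^ 4" by (simp add: power_divide flip: power_mult)
  also have "\<dots> \<le> 360 * real n * real n ^ 4"
    using n ln_le_minus_one[of "real n"] by (intro mult_mono) auto
  also have "\<dots> = 360 * real n ^ 5" by (simp add: power_Suc[symmetric] del: power_Suc)
  finally have "walk_length \<phi> n \<le> 360 * real n ^ 5 + 1"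
    using walk_length_bounds(2)[OF n, of \<phi>] by linarith
  also have "\<dots> \<le> 360 * real n ^ 5 + real n ^ 5" using n1 by simp
  also have "\<dots> \<le> 2 ^ 10 * real n ^ 5" by simp
  also have "\<dots> \<le> real n ^ 10 * real n ^ 5" using n by (intro mult_right_mono power_mono) auto
  also have "\<dots> = real (n ^ 15)" by (simp flip: power_add)
  finally show ?thesis by (simp only: of_nat_le_iff)
qed

text \<open>Since T \<le> n^15, the rounding error in the functional is at most n^21, far below n^38
  / 4. Numerical factors are absorbed by powers of n \<ge> 2.\<close>

lemma scale_large:
  assumes n: "2 \<le> n" and \<phi>: "1 / real n ^ 2 \<le> \<phi>"
  defines "T \<equiv> walk_length \<phi> n"
  shows "n\<^sup>2 * (2 * T + 3) < n ^ 40" "real (n\<^sup>2 * (n * (T + 2) + T)) < 1 / (4 * real n ^ 2) * real (n ^ 40)"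
proof -
  have T: "T \<le> n ^ 15" unfolding T_def by (rule walk_length_poly[OF n \<phi>])
  have n_pow: "2 ^ k * n ^ l \<le> n ^ (k + l)" for k l
    unfolding power_add using n by (intro mult_right_mono power_mono) auto
  have one: "1 \<le> n ^ 15" using n by simp
  have "2 * T + 3 \<le> 2 ^ 3 * n ^ 15" using T one by simp
  then have "n\<^sup>2 * (2 * T + 3) \<le> n\<^sup>2 * n ^ 18" using n_pow[of 3 15] by (intro mult_le_mono2) simp
  also have "\<dots> < n ^ 40" using n by (simp flip: power_add)
  finally show "n\<^sup>2 * (2 * T + 3) < n ^ 40" .
  have "T + 2 \<le> 2 ^ 2 * n ^ 15" using T one by simp
  then have "n * (T + 2) \<le> n * n ^ 17" using n_pow[of 2 15] by (intro mult_le_mono2) simp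
  moreover have "T \<le> n * n ^ 17" using T n_pow[of 3 15] by (simp flip: power_Suc)
  ultimately have "n * (T + 2) + T \<le> 2 ^ 1 * n ^ 18" by (simp flip: power_Suc)
  then have "n * (T + 2) + T \<le> n ^ 19" using n_pow[of 1 18] by simp
  moreover define A where "A = n\<^sup>2 * (n * (T + 2) + T)"
  ultimately have "A \<le> n\<^sup>2 * n ^ 19" by (metis mult_le_mono2)
  then have "A \<le> n ^ 21" by (simp flip: power_add)
  then have "2 ^ 2 * n ^ 2 * A \<le> 2 ^ 2 * n ^ 2 * n ^ 21" by (rule mult_le_mono2)
  also have "\<dots> = 2 ^ 2 * n ^ 23" by (simp flip: power_add)
  also have "\<dots> \<le> n ^ 25" using n_pow[of 2 23] by simp
  also have "\<dots> < n ^ 40" using n by simp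
  finally have "real (2 ^ 2 * n ^ 2 * A) < real (n ^ 40)" by (simp only: of_nat_less_iff)
  then have "real A < 1 / (4 * real n ^ 2) * real (n ^ 40)"
    using n by (simp add: field_simps)
  then show "real (n\<^sup>2 * (n * (T + 2) + T)) < 1 / (4 * real n ^ 2) * real (n ^ 40)"
    unfolding A_def .
qed

text \<open>For small x one has ln (1 - x) \<ge> -2x, and here 2 x T is at most 0.72 ln n + 1/500,
  hence at most ln n.\<close>

lemma walk_length_slow_decay:
  assumes n: "2 \<le> n" and \<phi>: "0 < \<phi>" "\<phi> \<le> 1"
  shows "1 / real n \<le> (1 - \<phi>\<^sup>2 / 1000) ^ walk_length \<phi> n"
proof -
  let ?T = "walk_length \<phi> n"
  define x where "x = \<phi>\<^sup>2 / 1000"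
  have p: "0 < \<phi>\<^sup>2" "\<phi>\<^sup>2 \<le> 1" using \<phi> by (auto simp: power_le_one)
  have x: "0 < x" "x \<le> 1 / 1000" using p by (auto simp: x_def)
  have "x * x \<le> 1 / 1000 * x" using x by (intro mult_right_mono) auto
  then have "- 2 * x \<le> - x - 2 * x\<^sup>2" using x by (simp add: power2_eq_square)
  also have "\<dots> \<le> ln (1 - x)" using x by (intro ln_one_minus_pos_lower_bound) auto
  finally have ln: "- 2 * x \<le> ln (1 - x)" .
  have "?T * \<phi>\<^sup>2 \<le> (360 * ln (real n) / \<phi>\<^sup>2 + 1) * \<phi>\<^sup>2"
    using walk_length_bounds(2)[OF n] p by (intro mult_right_mono) auto
  also have "\<dots> = 360 * ln (real n) + \<phi>\<^sup>2" using p by (simp add: distrib_right)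
  finally have "?T * (2 * x) \<le> ln (real n)"
    using p ln_ge_two_thirds[OF n] by (simp add: x_def)
  then have "exp (- ln (real n)) \<le> exp (?T * (- 2 * x))" by simp
  also have "\<dots> \<le> exp (?T * ln (1 - x))" using ln by (simp only: exp_le_cancel_iff mult_left_mono of_nat_0_le_iff)
  also have "\<dots> = (1 - x) ^ ?T" using x by (simp add: exp_of_nat_mult)
  finally show ?thesis using n by (simp add: x_def exp_minus inverse_eq_divide)
qed

text \<open>720 is 2 * 360. The additive 4, from the ceiling counted twice and the two extra rounds,
  is at most 10 ln n because ln n \<ge> 2/3.\<close>

lemma round_complexity:
  assumes n: "2 \<le> n" and "0 < \<epsilon>" "\<epsilon> < 1" "0 < \<Phi>" "\<Phi> \<le> 1" "\<Phi> \<le> \<phi>"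
  shows "real (2 * walk_length \<phi> n + 2) \<le> 730 * (ln (real (n + m)) / (\<epsilon> * \<Phi>\<^sup>2))"
proof -
  have p: "0 < \<Phi>\<^sup>2" "\<Phi>\<^sup>2 \<le> 1" using assms by (auto simp: power_le_one)
  have "\<Phi>\<^sup>2 \<le> \<phi>\<^sup>2" using assms by (intro power_mono) auto
  then have "360 * ln (real n) / \<phi>\<^sup>2 \<le> 360 * ln (real n) / \<Phi>\<^sup>2"
    using n p by (intro divide_left_mono mult_pos_pos) auto
  then have "real (2 * walk_length \<phi> n + 2) \<le> 720 * (ln (real n) / \<Phi>\<^sup>2) + 4"
    using walk_length_bounds(2)[OF n, of \<phi>] by simp
  also have "ln (real n) / 1 \<le> ln (real n) / \<Phi>\<^sup>2"
    using n p by (intro divide_left_mono) auto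
  then have "4 \<le> 10 * (ln (real n) / \<Phi>\<^sup>2)" using ln_ge_two_thirds[OF n] by simp
  then have "720 * (ln (real n) / \<Phi>\<^sup>2) + 4 \<le> 730 * (ln (real n) / \<Phi>\<^sup>2)" by simp
  also have "ln (real n) / \<Phi>\<^sup>2 \<le> ln (real (n + m)) / (\<epsilon> * \<Phi>\<^sup>2)"
    using n assms p by (intro frac_le) (auto simp: mult_le_cancel_right1)
  finally show ?thesis by simp
qed

lemma msg_bits_large:
  assumes "2 \<le> n" "k < c + 44"
  shows "n ^ k < 2 ^ msg_bits c n"
proof -
  have "real n = 2 powr log 2 (real n)" using assms by simp
  also have "\<dots> \<le> 2 powr real (nat \<lceil>log 2 (real n)\<rceil>)"
    by (intro powr_mono) (auto simp: real_nat_ceiling_ge)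
  also have "\<dots> = real (2 ^ nat \<lceil>log 2 (real n)\<rceil>)" by (simp add: powr_realpow)
  finally have le: "n \<le> 2 ^ nat \<lceil>log 2 (real n)\<rceil>" by (simp only: of_nat_le_iff)
  have "n ^ k < n ^ (c + 44)" using assms by (intro power_strict_increasing) auto
  also have "\<dots> \<le> (2 ^ nat \<lceil>log 2 (real n)\<rceil>) ^ (c + 44)" using le by (rule power_mono) simp
  also have "\<dots> = 2 ^ msg_bits c n" by (simp only: msg_bits_def power_mult[symmetric] mult.commute)
  finally show ?thesis .
qed

lemma msg_bits_le:
  assumes "2 \<le> n"
  shows "real (2 * msg_bits c n) \<le> real (4 * (c + 44)) * log 2 (real n)"
proof -
  have one: "1 \<le> log 2 (real n)" using assms by simp
  then have "real (nat \<lceil>log 2 (real n)\<rceil>) \<le> 2 * log 2 (real n)" by linarith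
  then have "real (c + 44) * real (nat \<lceil>log 2 (real n)\<rceil>) \<le> real (c + 44) * (2 * log 2 (real n))"
    by (rule mult_left_mono) simp
  then show ?thesis by (simp add: msg_bits_def algebra_simps)
qed

section \<open>Conductance, expansion and sparse cuts\<close>

context finite_graph
begin

lemma finite_conds: "finite {cond G S | S. S \<noteq> {} \<and> S \<subset> verts G \<and> vol G S \<le> vol G (verts G - S)}"
  by (rule finite_subset[of _ "cond G ` Pow (verts G)"]) (auto simp: finite_verts)

lemma conductance_le_cond:
  "S \<noteq> {} \<Longrightarrow> S \<subset> verts G \<Longrightarrow> vol G S \<le> vol G (verts G - S) \<Longrightarrow> conductance G \<le> cond G S"
  unfolding conductance_def by (rule Min_le[OF finite_conds]) blast

lemma conductance_attained:
  assumes "2 \<le> card (verts G)"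
  obtains S where "S \<noteq> {}" "S \<subset> verts G" "vol G S \<le> vol G (verts G - S)" "cond G S = conductance G"
proof -
  obtain v where v: "v \<in> verts G" using assms by fastforce
  have "verts G \<noteq> {v}" using assms by auto
  then have "{v} \<subset> verts G" "verts G - {v} \<noteq> {}" "verts G - {v} \<subset> verts G" "verts G - (verts G - {v}) = {v}"
    using v by auto
  then have "\<exists>S. S \<noteq> {} \<and> S \<subset> verts G \<and> vol G S \<le> vol G (verts G - S)"
    using linear[of "vol G {v}" "vol G (verts G - {v})"] by (metis insert_not_empty)
  then have "{cond G S | S. S \<noteq> {} \<and> S \<subset> verts G \<and> vol G S \<le> vol G (verts G - S)} \<noteq> {}" by blast
  from Min_in[OF finite_conds this] obtain S where S: "conductance G = cond G S" "S \<noteq> {}" "S \<subset> verts G"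
      "vol G S \<le> vol G (verts G - S)"
    unfolding conductance_def by blast
  show ?thesis by (rule that[OF S(2-4) S(1)[symmetric]])
qed

text \<open>An isolated vertex is a cut of conductance 0 / 0 = 0.\<close>

lemma degree_pos_if_conductance_pos:
  assumes "2 \<le> card (verts G)" "0 < conductance G" "v \<in> verts G"
  shows "0 < degree G v"
proof (rule ccontr)
  assume "\<not> ?thesis"
  then have "vol G {v} = 0" by (simp add: vol_def)
  moreover have "verts G \<noteq> {v}" using assms(1) by auto
  then have "{v} \<subset> verts G" using assms(3) by auto
  ultimately have "conductance G \<le> cond G {v}" by (intro conductance_le_cond) simp_all
  also have "cond G {v} = 0" by (simp add: cond_def \<open>vol G {v} = 0\<close>)
  finally show False using assms by simp
qed

end

context positive_degree_graph
begin

text \<open>If a cut is nonempty, its conductance is at least \<open>1 / n\<^sup>2\<close>.\<close>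
lemma expands_if_conductance:
  assumes "verts G \<noteq> {}" "0 < \<Phi>" "\<Phi> \<le> conductance G"
  shows "expands (threshold \<Phi> (card (verts G)))"
  unfolding expands_def
proof (intro allI impI)
  fix S assume S: "S \<subseteq> verts G \<and> 2 * vol G S \<le> vol G (verts G)"
  let ?cut = "real (card (edges_between G S (verts G - S)))"
  show "threshold \<Phi> (card (verts G)) * vol G S \<le> ?cut"
  proof (cases "vol G S = 0")
    case False
    then have ne: "S \<noteq> {}" "S \<noteq> verts G" "vol G S > 0" using S by (auto simp: vol_def)
    then have "conductance G \<le> cond G S" using S vol_Diff[of S] by (intro conductance_le_cond) auto
    then have "\<Phi> \<le> ?cut / vol G S" using assms by (simp add: cond_def)
    then have 1: "\<Phi> * vol G S \<le> ?cut" using ne by (simp add: le_divide_eq)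
    moreover have "0 < \<Phi> * vol G S" using assms ne by simp
    ultimately have "1 \<le> ?cut" by simp
    moreover have "vol G S \<le> (card (verts G))\<^sup>2" using vol_mono[of S "verts G"] vol_le S by simp
    then have "1 / real (card (verts G)) ^ 2 * vol G S \<le> 1"
      using assms(1) finite_verts by (simp add: divide_le_eq card_gt_0_iff flip: of_nat_power)
    ultimately show ?thesis using 1 by (auto simp: threshold_def max_def)
  qed simp
qed

text \<open>G has distance 0 from itself, while \<epsilon> m > 0 because there is an edge. So a far
  graph lacks the property, and a set attaining the minimum is the sparse cut.\<close>

lemma sparse_cut_if_eps_far:
  fixes \<delta> :: real
  assumes "2 \<le> card (verts G)" "0 < \<epsilon>" "eps_far \<epsilon> G (\<lambda>H. \<delta> \<le> conductance H)"
  obtains S where "S \<noteq> {}" "S \<subseteq> verts G" "2 * vol G S \<le> vol G (verts G)"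
    "card (edges_between G S (verts G - S)) \<le> \<delta> * vol G S"
proof -
  obtain v where v: "v \<in> verts G" using assms by fastforce
  have "finite (edges G)"
    by (rule finite_subset[of _ "Pow (verts G)"]) (auto simp: finite_verts elim: edgeE)
  moreover have "edges G \<noteq> {}" using degree_pos[OF v] by (auto simp: degree_def)
  ultimately have "0 < \<epsilon> * real (card (edges G))" using assms(2) by (simp add: card_gt_0_iff)
  then have "\<not> \<delta> \<le> conductance G" using assms(3) simple unfolding eps_far_def by force
  then obtain S where S: "S \<noteq> {}" "S \<subset> verts G" "vol G S \<le> vol G (verts G - S)" "cond G S < \<delta>"
    using conductance_attained[OF assms(1)] by (metis not_le)
  have "0 < degree G u" if "u \<in> S" for u using that S(2) by (intro degree_pos) auto
  moreover have "finite S" using S(2) finite_verts by (meson finite_subset psubset_imp_subset)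
  ultimately have "vol G S > 0" unfolding vol_def using S(1) by (intro sum_pos)
  then have "card (edges_between G S (verts G - S)) \<le> \<delta> * vol G S"
    using S(4) by (simp add: cond_def divide_less_eq)
  moreover have "2 * vol G S \<le> vol G (verts G)"
    using S(3) vol_Diff[of S] vol_mono[of S "verts G"] S(2) by auto
  ultimately show ?thesis using that S by blast
qed

end

lemma tester_execution_tester:
  assumes "valid_network c N" and n: "2 \<le> card (verts (graph N))"
  shows "tester_execution N c (\<lambda>n. n ^ 40) (msg_bits c)"
proof
  let ?n = "card (verts (graph N))"
  note large = msg_bits_large[OF n, of _ c]
  show "valid_network c N" by fact
  show "?n ^ c < 2 ^ msg_bits c ?n" by (rule large) simp
  have "Suc ?n * ?n ^ 40 \<le> (?n * ?n) * ?n ^ 40"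
    using mult_le_mono1[OF n, of ?n] n by (intro mult_le_mono1) linarith
  also have "\<dots> = ?n ^ 42" by (simp add: numeral_eq_Suc)
  also have "\<dots> < 2 ^ msg_bits c ?n" by (rule large) simp
  finally show "Suc ?n * ?n ^ 40 < 2 ^ msg_bits c ?n" .
  have "2 * ?n ^ 40 \<le> ?n * ?n ^ 40" using n by (rule mult_le_mono1)
  also have "\<dots> = ?n ^ 41" by (simp add: numeral_eq_Suc)
  also have "\<dots> < 2 ^ msg_bits c ?n" by (rule large) simp
  finally show "2 * ?n ^ 40 < 2 ^ msg_bits c ?n" .
  have "2 \<le> ?n ^ 1" using n by simp
  also have "\<dots> < 2 ^ msg_bits c ?n" by (rule large) simp
  finally show "2 < (2 :: nat) ^ msg_bits c ?n" .
qed

theorem theorem1p1: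
  fixes c :: nat
  shows "\<exists>(K :: real) (C :: real) (A :: real \<Rightarrow> real \<Rightarrow> nat algorithm).
    \<forall>\<epsilon> \<Phi>. 0 < \<epsilon> \<and> \<epsilon> < 1 \<and> 0 < \<Phi> \<and> \<Phi> \<le> 1 \<longrightarrow>
      (\<forall>N :: 'a network. valid_network c N \<and> card (verts (graph N)) \<ge> 2 \<longrightarrow>
        congest K (A \<epsilon> \<Phi>) N \<and>
        (\<exists>t. real t \<le> C * (ln (real (card (verts (graph N)) + card (edges (graph N)))) / (\<epsilon> * \<Phi>\<^sup>2)) \<and>
          terminates_within (A \<epsilon> \<Phi>) N t \<and>
          (conductance (graph N) \<ge> \<Phi> \<longrightarrow>
            measure_pmf.prob (run (A \<epsilon> \<Phi>) N t) (all_accept (A \<epsilon> \<Phi>) N) \<ge> 2 / 3) \<and>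
          (eps_far \<epsilon> (graph N) (\<lambda>H. conductance H \<ge> \<Phi>\<^sup>2 / 1000) \<longrightarrow>
            measure_pmf.prob (run (A \<epsilon> \<Phi>) N t) (some_reject (A \<epsilon> \<Phi>) N) \<ge> 2 / 3)))"
proof (rule exI[of _ "real (4 * (c + 44))"], rule exI[of _ 730],
    rule exI[of _ "\<lambda>\<epsilon> \<Phi>. tester (\<lambda>n. walk_length (threshold \<Phi> n) n) (\<lambda>n. n ^ 40) (msg_bits c)"],
    intro allI impI, elim conjE)
  fix \<epsilon> \<Phi> :: real and N :: "'a network"
  assume \<epsilon>: "0 < \<epsilon>" "\<epsilon> < 1" and \<Phi>: "0 < \<Phi>" "\<Phi> \<le> 1"
    and valid: "valid_network c N" and n: "2 \<le> card (verts (graph N))"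
  let ?T = "\<lambda>n. walk_length (threshold \<Phi> n) n"
  interpret tester_execution N c ?T "\<lambda>n. n ^ 40" "msg_bits c"
    by (rule tester_execution_tester[OF valid n])
  define \<phi> where "\<phi> = threshold \<Phi> n"
  have "1 / real n ^ 2 \<le> 1" using n by simp
  then have \<phi>: "0 < \<phi>" "\<phi> \<le> 1" "\<Phi> \<le> \<phi>" "1 / real n ^ 2 \<le> \<phi>"
    using \<Phi> by (auto simp: \<phi>_def threshold_def)
  let ?t = "2 * walk_length \<phi> n + 2"
  have congest: "congest (real (4 * (c + 44))) Alg N"
    using n by (intro congest_tester msg_bits_le[OF n]) simp
  have rounds: "real ?t \<le> 730 * (ln (real (n + card (edges G))) / (\<epsilon> * \<Phi>\<^sup>2))"
    by (rule round_complexity[OF n \<epsilon> \<Phi> \<phi>(3)])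
  have accept: "measure_pmf.prob (run Alg N ?t) (all_accept Alg N) \<ge> 2 / 3" if cond: "\<Phi> \<le> conductance G"
  proof -
    interpret positive_degree_graph G
      by unfold_locales (use degree_pos_if_conductance_pos n \<Phi> cond in auto)
    have V: "V \<noteq> {}" using n by auto
    have "expands \<phi>" unfolding \<phi>_def by (rule expands_if_conductance[OF V \<Phi>(1) cond])
    moreover have "inj_on (ident N) V" using valid by (simp add: valid_network_def)
    moreover have "n\<^sup>2 \<le> n ^ 40" using n by (intro power_increasing) auto
    ultimately have "accepts G (ident N) (walk_length \<phi> n) (n ^ 40) \<zeta> v"
      if "\<And>v. v \<in> V \<Longrightarrow> \<zeta> v \<le> 2" "v \<in> V" for \<zeta> v
      using accepts_if_expands[of \<phi> "ident N" "n ^ 40" "walk_length \<phi> n" \<zeta> v] \<phi> n that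
        walk_length_mixing[OF n \<phi>(1,2)] by simp
    then show ?thesis
      using all_accept_tester unfolding \<phi>_def by simp
  qed
  have reject: "measure_pmf.prob (run Alg N ?t) (some_reject Alg N) \<ge> 2 / 3"
    if far: "eps_far \<epsilon> G (\<lambda>H. \<Phi>\<^sup>2 / 1000 \<le> conductance H)"
  proof (cases "\<forall>v\<in>V. 0 < degree G v")
    case True
    interpret positive_degree_graph G by unfold_locales (use True in auto)
    obtain S where S: "S \<noteq> {}" "S \<subseteq> V" "2 * vol G S \<le> vol G V"
      "card (edges_between G S (V - S)) \<le> \<Phi>\<^sup>2 / 1000 * vol G S"
      using sparse_cut_if_eps_far[OF n \<epsilon>(1) far] .
    \<comment> \<open>The cut is sparse relative to \<Phi>, hence also relative to the larger \<phi>
      that determines the walk length.\<close>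
    have "\<Phi>\<^sup>2 \<le> \<phi>\<^sup>2" using \<Phi> \<phi> by (intro power_mono) auto
    then have "\<Phi>\<^sup>2 / 1000 * vol G S \<le> \<phi>\<^sup>2 / 1000 * vol G S" by (intro mult_right_mono) auto
    with S(4) have cut: "card (edges_between G S (V - S)) \<le> \<phi>\<^sup>2 / 1000 * vol G S" by linarith
    have "\<phi>\<^sup>2 \<le> 1" using \<phi> by (simp add: power_le_one)
    then have small: "\<phi>\<^sup>2 / 1000 \<le> 1" by simp
    \<comment> \<open>r = 1 / (4 n^2) is the largest value permitted by the decay bound 1/n.\<close>
    have "4 * n * (1 / (4 * real n ^ 2)) = 1 / n" using n by (simp add: power2_eq_square)
    then have r: "4 * n * (1 / (4 * real n ^ 2)) \<le> (1 - \<phi>\<^sup>2 / 1000) ^ walk_length \<phi> n"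
      using walk_length_slow_decay[OF n \<phi>(1,2)] by simp
    obtain \<gamma> :: "'a \<Rightarrow> real" and v where "v \<in> V" "2 * (1 / (4 * real n ^ 2)) \<le> \<bar>\<gamma> v\<bar>"
      "\<And>\<zeta>. (\<And>v. v \<in> V \<Longrightarrow> accepts G (ident N) (walk_length \<phi> n) (n ^ 40) \<zeta> v) \<Longrightarrow>
         \<bar>\<Sum>v\<in>V. \<gamma> v * real (\<zeta> v)\<bar> < 1 / (4 * real n ^ 2)"
      by (rule sparse_cut_rejection[OF S(1-3) cut small scale_large[OF n \<phi>(4)] r, where i = "ident N"]) blast
    then show ?thesis unfolding \<phi>_def by (rule some_reject_of_functional)
  next
    case False
    \<comment> \<open>An isolated vertex rejects whatever the seeds are.\<close>
    then have none: "{s'. \<forall>v\<in>V. accepts G (ident N) (walk_length \<phi> n) (n ^ 40) (seed s') v} = {}"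
      by (auto simp: accepts_def)
    have "measure_pmf.prob first_draw {s'. \<forall>v\<in>V. accepts G (ident N) (walk_length \<phi> n) (n ^ 40) (seed s') v} \<le> 1 / 3"
      unfolding none by simp
    then show ?thesis unfolding \<phi>_def by (rule some_reject_tester)
  qed
  show "congest (real (4 * (c + 44))) Alg N \<and>
    (\<exists>t. real t \<le> 730 * (ln (real (n + card (edges G))) / (\<epsilon> * \<Phi>\<^sup>2)) \<and>
      terminates_within Alg N t \<and>
      (\<Phi> \<le> conductance G \<longrightarrow> 2 / 3 \<le> measure_pmf.prob (run Alg N t) (all_accept Alg N)) \<and>
      (eps_far \<epsilon> G (\<lambda>H. \<Phi>\<^sup>2 / 1000 \<le> conductance H) \<longrightarrow>
        2 / 3 \<le> measure_pmf.prob (run Alg N t) (some_reject Alg N)))"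
    using congest rounds accept reject terminates_tester unfolding \<phi>_def by blast
qed

end
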